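(* Let $G$ be any connected graph and let $U\subseteq V(G)$ be any vertex set. Then the following two assertions are complementary, i.e., exactly one of them holds: (i) $G$ contains an undominating star attached to $U$; (ii) $G$ has a tough subgraph $H\subseteq G$ that contains $U$ (i.e. $U\subseteq V(H)$).
   Context: Graphs may be infinite of arbitrary cardinality. A comb is the union of a ray $R$ with infinitely many disjoint finite paths (possibly trivial) that have precisely their first vertex on $R$; the last vertices of these paths are the teeth of the comb. A star attached to $U$ is a subdivided infinite star all of whose leaves lie in $U$. A subdivided infinite star $S$ dominates a comb $C$ if infinitely many of the leaves of $S$ are also teeth of $C$. A subdivided star $S\subseteq G$ is dominating in $G$ if it dominates some comb $C\subseteq G$, and it is undominating in $G$ otherwise. A graph $H$ is tough if for every finite $X\subseteq V(H)$ the graph $H-X$ has only finitely many components. *)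

theory Defs
  imports Main
begin

text \<open>
  Simple undirected graphs, given by a vertex set and a set of two-element edges. The vertex type
  is arbitrary, so there is no restriction on cardinalities.
\<close>

record 'a graph =
  verts :: "'a set"
  edges :: "'a set set"

definition simple_graph :: "'a graph \<Rightarrow> bool" where
  "simple_graph G \<longleftrightarrow> (\<forall>e\<in>edges G. \<exists>u\<in>verts G. \<exists>v\<in>verts G. u \<noteq> v \<and> e = {u, v})"

definition subgraph :: "'a graph \<Rightarrow> 'a graph \<Rightarrow> bool" where
  "subgraph H G \<longleftrightarrow> simple_graph H \<and> verts H \<subseteq> verts G \<and> edges H \<subseteq> edges G"

definition delete_verts :: "'a graph \<Rightarrow> 'a set \<Rightarrow> 'a graph" where
  "delete_verts G X = \<lparr>verts = verts G - X, edges = {e \<in> edges G. e \<inter> X = {}}\<rparr>"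

definition graph_Union :: "'a graph set \<Rightarrow> 'a graph" where
  "graph_Union \<G> = \<lparr>verts = \<Union> (verts ` \<G>), edges = \<Union> (edges ` \<G>)\<rparr>"

text \<open>
  A finite path is presented by the list of its vertices in order, a ray by the sequence of its
  vertices. A one-element list is a trivial path.
\<close>

definition is_path :: "'a list \<Rightarrow> bool" where
  "is_path p \<longleftrightarrow> p \<noteq> [] \<and> distinct p"

definition path_graph :: "'a list \<Rightarrow> 'a graph" where
  "path_graph p = \<lparr>verts = set p, edges = {{p ! i, p ! Suc i} | i. Suc i < length p}\<rparr>"

definition ray_graph :: "(nat \<Rightarrow> 'a) \<Rightarrow> 'a graph" where
  "ray_graph r = \<lparr>verts = range r, edges = {{r i, r (Suc i)} | i. True}\<rparr>"

text \<open>Connected graphs, and hence components, are non-empty by convention.\<close>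

definition connected_graph :: "'a graph \<Rightarrow> bool" where
  "connected_graph G \<longleftrightarrow> simple_graph G \<and> verts G \<noteq> {} \<and>
     (\<forall>u\<in>verts G. \<forall>v\<in>verts G.
        \<exists>p. is_path p \<and> hd p = u \<and> last p = v \<and> subgraph (path_graph p) G)"

definition components :: "'a graph \<Rightarrow> 'a graph set" where
  "components G = {C. subgraph C G \<and> connected_graph C \<and>
     (\<forall>D. subgraph D G \<and> connected_graph D \<and> subgraph C D \<longrightarrow> D = C)}"

definition tough :: "'a graph \<Rightarrow> bool" where
  "tough H \<longleftrightarrow> (\<forall>X. finite X \<and> X \<subseteq> verts H \<longrightarrow> finite (components (delete_verts H X)))"

text \<open>
  The graph of a comb does not determine its teeth: the same graph can be decomposed into a ray
  and disjoint paths in several ways. The set \<open>T\<close> of teeth is therefore part of the data.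
\<close>

definition comb :: "'a graph \<Rightarrow> 'a set \<Rightarrow> bool" where
  "comb C T \<longleftrightarrow> (\<exists>r P. inj r \<and> infinite P \<and>
     (\<forall>p\<in>P. is_path p \<and> set p \<inter> range r = {hd p}) \<and>
     (\<forall>p\<in>P. \<forall>q\<in>P. p \<noteq> q \<longrightarrow> set p \<inter> set q = {}) \<and>
     C = graph_Union (insert (ray_graph r) (path_graph ` P)) \<and>
     T = last ` P)"

text \<open>
  A subdivision of a star with infinitely many leaves (of any infinite cardinality): a union of
  infinitely many non-trivial paths that start in the centre \<open>c\<close> and are otherwise disjoint.
\<close>

definition subdivided_star :: "'a graph \<Rightarrow> bool" where
  "subdivided_star S \<longleftrightarrow> (\<exists>c P. infinite P \<and>
     (\<forall>p\<in>P. is_path p \<and> hd p = c \<and> length p \<ge> 2) \<and>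
     (\<forall>p\<in>P. \<forall>q\<in>P. p \<noteq> q \<longrightarrow> set p \<inter> set q = {c}) \<and>
     S = graph_Union (path_graph ` P))"

definition leaves :: "'a graph \<Rightarrow> 'a set" where
  "leaves S = {v \<in> verts S. \<exists>!e. e \<in> edges S \<and> v \<in> e}"

definition star_attached_to :: "'a graph \<Rightarrow> 'a set \<Rightarrow> bool" where
  "star_attached_to S U \<longleftrightarrow> subdivided_star S \<and> leaves S \<subseteq> U"

definition dominates :: "'a graph \<Rightarrow> 'a graph \<Rightarrow> bool" where
  "dominates S C \<longleftrightarrow> (\<exists>T. comb C T \<and> infinite (leaves S \<inter> T))"

definition dominating_in :: "'a graph \<Rightarrow> 'a graph \<Rightarrow> bool" where
  "dominating_in S G \<longleftrightarrow> (\<exists>C. subgraph C G \<and> dominates S C)"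

end

theory Submission
  imports Defs
begin

text \<open>
  Call \<open>U\<close> unsplit in \<open>A\<close> if, for every finite \<open>X\<close>, only finitely many components of \<open>A - X\<close>
  meet \<open>U\<close>. Both assertions are decided by whether \<open>U\<close> is unsplit in \<open>G\<close>. If it is not, some
  \<open>c \<in> X\<close> has neighbours in infinitely many components of \<open>G - X\<close> that meet \<open>U\<close>, and the
  resulting star is undominated since the ray of a comb has a tail in a single component. If \<open>H\<close>
  is tough, every infinite subset of its vertices is unsplit in \<open>H\<close>, and descending through
  components that contain infinitely many of these vertices builds a comb with teeth among them.

  If \<open>U\<close> is unsplit, Zorn's lemma gives a maximal tough vertex set \<open>W\<close> for a suitable order. If
  \<open>W\<close> missed some \<open>u \<in> U\<close>, consider the component \<open>D\<close> of \<open>G - W\<close> at \<open>u\<close>: when \<open>D\<close> has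
  finitely many neighbours in \<open>W\<close>, add a finite connected part of \<open>D\<close> adjacent to all of them;
  otherwise the star-comb dichotomy in \<open>D\<close> yields a connected set with infinitely many neighbours
  in \<open>W\<close> that may be added.
\<close>

section \<open>Connectedness inside a vertex set\<close>

text \<open>The conjunct \<open>x \<in> A\<close> is needed because the reflexive closure relates
  every vertex to itself, even one outside \<open>A\<close>. With it, \<open>joined\<close> implies
  that both ends lie in \<open>A\<close>.\<close>

definition joined :: "'a set set \<Rightarrow> 'a set \<Rightarrow> 'a \<Rightarrow> 'a \<Rightarrow> bool" where
  "joined E A x y \<longleftrightarrow> x \<in> A \<and> (\<lambda>x y. x \<in> A \<and> y \<in> A \<and> {x, y} \<in> E)\<^sup>*\<^sup>* x y"

text \<open>Components are handled as vertex sets named by a member. If \<open>x\<close> lies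
  outside \<open>A\<close> the value is empty, so no side condition on \<open>x\<close> is
  needed.\<close>

definition comp_of :: "'a set set \<Rightarrow> 'a set \<Rightarrow> 'a \<Rightarrow> 'a set" where
  "comp_of E A x = {y. joined E A x y}"

definition conn :: "'a set set \<Rightarrow> 'a set \<Rightarrow> bool" where
  "conn E A \<longleftrightarrow> (\<forall>x\<in>A. \<forall>y\<in>A. joined E A x y)"

definition path_in :: "'a set set \<Rightarrow> 'a set \<Rightarrow> 'a list \<Rightarrow> bool" where
  "path_in E A p \<longleftrightarrow> is_path p \<and> set p \<subseteq> A \<and> successively (\<lambda>x y. {x, y} \<in> E) p"

lemma joined_refl: "x \<in> A \<Longrightarrow> joined E A x x"
  by (simp add: joined_def)

lemma joined_edge: "\<lbrakk>x \<in> A; y \<in> A; {x, y} \<in> E\<rbrakk> \<Longrightarrow> joined E A x y"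
  by (auto simp: joined_def)

lemma joined_in: assumes "joined E A x y" shows "x \<in> A" "y \<in> A"
proof -
  show "x \<in> A" using assms by (simp add: joined_def)
  have "(\<lambda>x y. x \<in> A \<and> y \<in> A \<and> {x, y} \<in> E)\<^sup>*\<^sup>* x y" using assms by (simp add: joined_def)
  then show "y \<in> A" by (induction) (use \<open>x \<in> A\<close> in auto)
qed

lemma joined_trans: "\<lbrakk>joined E A x y; joined E A y z\<rbrakk> \<Longrightarrow> joined E A x z"
  unfolding joined_def by (blast intro: rtranclp_trans)

lemma joined_sym: assumes "joined E A x y" shows "joined E A y x"
proof -
  let ?r = "\<lambda>x y. x \<in> A \<and> y \<in> A \<and> {x, y} \<in> E"
  have "symp ?r" by (auto intro: sympI simp: insert_commute)
  then have "symp ?r\<^sup>*\<^sup>*" by (rule symp_rtranclp)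
  moreover have "?r\<^sup>*\<^sup>* x y" using assms unfolding joined_def by (rule conjunct2)
  ultimately have "?r\<^sup>*\<^sup>* y x" by (rule sympD)
  then show ?thesis using joined_in(2)[OF assms] unfolding joined_def by (intro conjI)
qed

lemma joined_induct [consumes 1, case_names refl step]:
  assumes "joined E A x y" "P x"
    and "\<And>y z. \<lbrakk>joined E A x y; P y; z \<in> A; {y, z} \<in> E\<rbrakk> \<Longrightarrow> P z"
  shows "P y"
proof -
  have x: "x \<in> A" and "(\<lambda>x y. x \<in> A \<and> y \<in> A \<and> {x, y} \<in> E)\<^sup>*\<^sup>* x y"
    using assms(1) unfolding joined_def by (rule conjunct1, rule conjunct2)
  from this(2) show ?thesis
  proof induction
    case (step y z)
    then show ?case using assms(3)[of y z] x by (simp add: joined_def)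
  qed (rule assms(2))
qed

lemma joined_mono:
  assumes "joined E A x y" "A \<subseteq> B"
  shows "joined E B x y"
  using assms(1)
proof (induction rule: joined_induct)
  case refl show ?case using assms(2) joined_in(1)[OF assms(1)] joined_refl[of x B] by auto
next
  case (step y z)
  then have "joined E B y z" using assms(2) joined_in(2)[of E A x y] by (intro joined_edge) auto
  with step.IH show ?case by (rule joined_trans)
qed

lemma joined_edge_cong:
  assumes "\<And>x y. \<lbrakk>x \<in> A; y \<in> A\<rbrakk> \<Longrightarrow> {x, y} \<in> E \<longleftrightarrow> {x, y} \<in> E'"
  shows "joined E A = joined E' A"
proof -
  have "(\<lambda>x y. x \<in> A \<and> y \<in> A \<and> {x, y} \<in> E) = (\<lambda>x y. x \<in> A \<and> y \<in> A \<and> {x, y} \<in> E')"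
    using assms by auto
  then show ?thesis by (auto simp: joined_def fun_eq_iff)
qed

text \<open>A walk from inside \<open>K\<close> to outside \<open>K\<close> has a first edge leaving
  \<open>K\<close>; its inner end \<open>a\<close> is still reachable from \<open>x\<close>.\<close>

lemma joined_exit:
  assumes "joined E A x y" "x \<in> K" "y \<notin> K"
  obtains a b where "a \<in> K" "b \<notin> K" "joined E A x a" "b \<in> A" "{a, b} \<in> E"
proof -
  have "y \<in> K \<or> (\<exists>a b. a \<in> K \<and> b \<notin> K \<and> joined E A x a \<and> b \<in> A \<and> {a, b} \<in> E)"
    using assms(1) by (induction rule: joined_induct) (use assms(2) in blast)+
  then show ?thesis using assms(3) that by blast
qed

lemma joined_closed:
  assumes "joined E B x y" "x \<in> K" "\<And>a b. \<lbrakk>a \<in> K; b \<in> B; {a, b} \<in> E\<rbrakk> \<Longrightarrow> b \<in> K"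
  shows "joined E (K \<inter> B) x y"
  using assms(1)
proof (induction rule: joined_induct)
  case refl show ?case using assms(2) joined_in(1)[OF assms(1)] joined_refl[of x "K \<inter> B"] by auto
next
  case (step y z)
  then have "y \<in> K \<inter> B" using joined_in(2)[OF step.IH] by simp
  then have "joined E (K \<inter> B) y z" using step assms(3)[of y z] by (intro joined_edge) auto
  with step.IH show ?case by (rule joined_trans)
qed

lemma comp_of_subset: "comp_of E A x \<subseteq> A"
  using joined_in(2)[of E A x] by (auto simp: comp_of_def)

lemma comp_of_self: "x \<in> A \<Longrightarrow> x \<in> comp_of E A x"
  by (simp add: comp_of_def joined_refl)

lemma comp_of_closed: "\<lbrakk>a \<in> comp_of E A x; b \<in> A; {a, b} \<in> E\<rbrakk> \<Longrightarrow> b \<in> comp_of E A x"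
  using joined_in(2)[of E A x a] joined_edge[of a A b E] joined_trans[of E A x a b]
  by (simp add: comp_of_def)

text \<open>A walk that starts in a component of \<open>A\<close> never leaves it, whatever further
  vertices \<open>X\<close> it avoids. The case \<open>X = {}\<close> shows that components are
  connected; general \<open>X\<close> lets splitting be examined one component at a time.\<close>

lemma joined_comp_of:
  assumes "joined E (A - X) y z" "y \<in> comp_of E A x"
  shows "joined E (comp_of E A x - X) y z"
proof -
  have "joined E (comp_of E A x \<inter> (A - X)) y z"
    using assms comp_of_closed[of _ E A x] by (intro joined_closed) auto
  then show ?thesis by (rule joined_mono) auto
qed

lemma conn_comp_of: "conn E (comp_of E A x)"
  unfolding conn_def
proof (intro ballI)
  fix y z assume y: "y \<in> comp_of E A x" and z: "z \<in> comp_of E A x"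
  then have "joined E (A - {}) y z"
    using joined_trans[OF joined_sym[of E A x y], of z] by (simp add: comp_of_def)
  from joined_comp_of[OF this y] show "joined E (comp_of E A x) y z" by simp
qed

lemma comp_of_eq: "joined E A x y \<Longrightarrow> comp_of E A x = comp_of E A y"
  using joined_trans[of E A x y] joined_trans[OF joined_sym, of E A x y] by (auto simp: comp_of_def)

lemma conn_star:
  assumes "\<And>y. y \<in> A \<Longrightarrow> joined E A c y"
  shows "conn E A"
  unfolding conn_def
proof (intro ballI)
  fix x y assume "x \<in> A" "y \<in> A"
  then show "joined E A x y" using assms joined_trans[OF joined_sym, of E A c x y] by blast
qed

lemma conn_joined: "\<lbrakk>conn E A; x \<in> A; y \<in> A; A \<subseteq> B\<rbrakk> \<Longrightarrow> joined E B x y"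
  unfolding conn_def using joined_mono[of E A x y B] by blast

text \<open>Follow a walk in \<open>D\<close> from \<open>x\<close> to a vertex of \<open>X\<close>:
  the edge on which it first leaves the component of \<open>D - X\<close> at \<open>x\<close> must
  end in \<open>X\<close>.\<close>

lemma conn_neighbour:
  assumes "conn E D" "x \<in> D - X" "D \<inter> X \<noteq> {}"
  obtains a b where "joined E (D - X) x a" "b \<in> X \<inter> D" "{b, a} \<in> E"
proof -
  obtain y where y: "y \<in> D" "y \<in> X" using assms(3) by auto
  have "joined E D x y" using assms y by (auto simp: conn_def)
  moreover have "x \<in> comp_of E (D - X) x" using comp_of_self[OF assms(2)] .
  moreover have "y \<notin> comp_of E (D - X) x" using y comp_of_subset[of E "D - X" x] by auto
  ultimately obtain a b where ab: "a \<in> comp_of E (D - X) x" "b \<notin> comp_of E (D - X) x" "b \<in> D" "{a, b} \<in> E"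
    by (rule joined_exit)
  then have "b \<in> X" using comp_of_closed[of a E "D - X" x b] by auto
  then show ?thesis using that[of a b] ab by (auto simp: comp_of_def insert_commute)
qed

section \<open>Finite paths and connected graphs\<close>

lemma path_in_mono: "\<lbrakk>path_in E A p; A \<subseteq> B\<rbrakk> \<Longrightarrow> path_in E B p"
  by (auto simp: path_in_def)

lemma path_in_append:
  assumes "path_in E A (p @ q)"
  shows "p \<noteq> [] \<Longrightarrow> path_in E A p" "q \<noteq> [] \<Longrightarrow> path_in E A q"
  using assms by (auto simp: path_in_def is_path_def successively_append_iff)

lemma path_in_joined:
  assumes "path_in E A p" "y \<in> set p"
  shows "joined E (set p) (hd p) y"
proof -
  have "successively (\<lambda>x y. {x, y} \<in> E) p \<Longrightarrow> y \<in> set p \<Longrightarrow> joined E (set p) (hd p) y"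
  \<comment> \<open>Induction from the right end keeps \<open>hd p\<close> fixed while the path
    grows.\<close>
  proof (induction p arbitrary: y rule: rev_induct)
    case (snoc z p)
    show ?case
    proof (cases "p = []")
      case False
      have IH: "joined E (set (p @ [z])) (hd p) y" if "y \<in> set p" for y
      proof (rule joined_mono)
        show "joined E (set p) (hd p) y"
          using snoc.IH[of y] snoc.prems(1) that by (simp add: successively_append_iff)
      qed auto
      have "joined E (set (p @ [z])) (last p) z"
        using snoc.prems False by (intro joined_edge) (auto simp: successively_append_iff)
      then have "joined E (set (p @ [z])) (hd p) z"
        using IH[of "last p"] False joined_trans by (metis last_in_set)
      then show ?thesis using IH[of y] snoc.prems(2) False by auto
    qed (use snoc in \<open>auto intro: joined_refl\<close>)
  qed auto
  then show ?thesis using assms by (auto simp: path_in_def)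
qed

lemma path_in_conn: "path_in E A p \<Longrightarrow> conn E (set p)"
  by (rule conn_star) (rule path_in_joined)

lemma joined_path:
  assumes "joined E A x y"
  obtains p where "path_in E A p" "hd p = x" "last p = y"
proof -
  have "\<exists>p. path_in E A p \<and> hd p = x \<and> last p = y"
    using assms
  proof (induction rule: joined_induct)
    case refl
    then show ?case using joined_in(1)[OF assms]
      by (intro exI[of _ "[x]"]) (auto simp: path_in_def is_path_def)
  next
    case (step y z)
    then obtain p where p: "path_in E A p" "hd p = x" "last p = y" by auto
    show ?case
    proof (cases "z \<in> set p")
      \<comment> \<open>If the walk returns to a vertex already on the path, the path is cut off
        there, which keeps it free of repetitions.\<close>
      case True
      then obtain q r where qr: "p = q @ z # r" by (meson split_list)
      then have "path_in E A ((q @ [z]) @ r)" using p by simp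
      then have "path_in E A (q @ [z])" by (rule path_in_append) auto
      moreover have "hd (q @ [z]) = x" using p qr by (cases q) auto
      ultimately show ?thesis by auto
    next
      case False
      then show ?thesis using p step by (intro exI[of _ "p @ [z]"])
        (auto simp: path_in_def is_path_def successively_append_iff)
    qed
  qed
  then show ?thesis using that by auto
qed

lemma path_graph_subgraph:
  assumes "is_path p"
  shows "subgraph (path_graph p) G \<longleftrightarrow> path_in (edges G) (verts G) p"
proof -
  have "\<exists>u\<in>set p. \<exists>v\<in>set p. u \<noteq> v \<and> {p ! i, p ! Suc i} = {u, v}" if "Suc i < length p" for i
    using assms that unfolding is_path_def
    by (intro bexI[of _ "p ! i"] bexI[of _ "p ! Suc i"]) (auto simp: nth_eq_iff_index_eq)
  then have "simple_graph (path_graph p)"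
    unfolding simple_graph_def path_graph_def by auto
  then show ?thesis using assms
    by (auto simp: subgraph_def path_in_def path_graph_def successively_conv_nth)
qed

lemma connected_graph_iff:
  "connected_graph G \<longleftrightarrow> simple_graph G \<and> verts G \<noteq> {} \<and> conn (edges G) (verts G)"
proof -
  have "(\<exists>p. is_path p \<and> hd p = u \<and> last p = v \<and> subgraph (path_graph p) G) \<longleftrightarrow>
    joined (edges G) (verts G) u v" for u v
  proof
    assume "\<exists>p. is_path p \<and> hd p = u \<and> last p = v \<and> subgraph (path_graph p) G"
    then obtain p where p: "is_path p" "hd p = u" "last p = v" "path_in (edges G) (verts G) p"
      using path_graph_subgraph by metis
    then show "joined (edges G) (verts G) u v"
      using path_in_joined[OF p(4), of v] joined_mono[of _ "set p"]
      by (auto simp: path_in_def is_path_def)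
  next
    assume "joined (edges G) (verts G) u v"
    then show "\<exists>p. is_path p \<and> hd p = u \<and> last p = v \<and> subgraph (path_graph p) G"
      by (rule joined_path) (metis path_graph_subgraph path_in_def)
  qed
  then show ?thesis unfolding connected_graph_def conn_def by auto
qed

section \<open>Sets split by no finite set of vertices\<close>

text \<open>Finiteness of the set of components meeting \<open>U\<close> is expressed by a finite
  set \<open>R\<close> of representatives, which avoids counting components. Since \<open>U\<close>
  is intersected with \<open>A\<close>, the notion applies to subregions \<open>A\<close> that
  contain only part of \<open>U\<close>.\<close>

definition unsplit :: "'a set set \<Rightarrow> 'a set \<Rightarrow> 'a set \<Rightarrow> bool" where
  "unsplit E A U \<longleftrightarrow> (\<forall>X. finite X \<longrightarrow>
     (\<exists>R. finite R \<and> (\<forall>u\<in>U \<inter> A - X. \<exists>r\<in>R. joined E (A - X) r u)))"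

text \<open>Maximality among connected subgraphs forces a component to be induced on its vertex set,
  so components are determined by any of their vertices.\<close>

lemma components_eq:
  assumes "simple_graph G"
  shows "components G = (\<lambda>v. \<lparr>verts = comp_of (edges G) (verts G) v,
    edges = {e \<in> edges G. e \<subseteq> comp_of (edges G) (verts G) v}\<rparr>) ` verts G"
    (is "_ = ?c ` _")
proof -
  let ?E = "edges G" and ?V = "verts G"
  have c: "subgraph (?c v) G" "connected_graph (?c v)" if v: "v \<in> ?V" for v
  proof -
    have s: "simple_graph (?c v)"
      unfolding simple_graph_def
    proof
      fix e assume "e \<in> edges (?c v)"
      then have e: "e \<in> ?E" "e \<subseteq> comp_of ?E ?V v" by auto
      then obtain a b where "a \<noteq> b" "e = {a, b}" using assms by (fastforce simp: simple_graph_def)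
      then show "\<exists>a\<in>verts (?c v). \<exists>b\<in>verts (?c v). a \<noteq> b \<and> e = {a, b}" using e by auto
    qed
    then show "subgraph (?c v) G"
      using comp_of_subset[of ?E ?V v] by (auto simp: subgraph_def)
    have "joined ?E (comp_of ?E ?V v) = joined (edges (?c v)) (comp_of ?E ?V v)"
      by (rule joined_edge_cong) simp
    then have "conn (edges (?c v)) (verts (?c v))"
      using conn_comp_of[of ?E ?V v] by (simp add: conn_def)
    then show "connected_graph (?c v)"
      using s comp_of_self[OF v] by (auto simp: connected_graph_iff)
  qed
  \<comment> \<open>Every connected subgraph through \<open>v\<close> lies in the induced graph at
    \<open>v\<close>. This gives both maximality of that graph and the fact that no other component
    contains \<open>v\<close>.\<close>
  have max: "subgraph D (?c v)" if D: "subgraph D G" "connected_graph D" "v \<in> verts D" for D v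
  proof -
    have sub: "verts D \<subseteq> comp_of ?E ?V v"
    proof
      fix x assume "x \<in> verts D"
      then have "joined (edges D) (verts D) v x" using D by (auto simp: connected_graph_iff conn_def)
      then have "joined ?E ?V v x"
      proof (induction rule: joined_induct)
        case refl
        show ?case using D(1,3) joined_refl[of v ?V] by (auto simp: subgraph_def)
      next
        case (step y z)
        then have "joined ?E ?V y z"
          using D(1) joined_in(2)[OF step.IH] by (intro joined_edge) (auto simp: subgraph_def)
        with step.IH show ?case by (rule joined_trans)
      qed
      then show "x \<in> comp_of ?E ?V v" by (simp add: comp_of_def)
    qed
    have "e \<subseteq> verts D" if "e \<in> edges D" for e
    proof -
      have "\<exists>u\<in>verts D. \<exists>v\<in>verts D. u \<noteq> v \<and> e = {u, v}"
        using D(1) that by (simp add: subgraph_def simple_graph_def)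
      then show ?thesis by auto
    qed
    then show ?thesis using sub D by (auto simp: subgraph_def)
  qed
  have anti: "C = D" if "subgraph C D" "subgraph D C" for C D :: "'a graph"
    using that by (intro graph.equality) (auto simp: subgraph_def)
  show ?thesis
  proof (intro set_eqI iffI)
    fix C assume C: "C \<in> components G"
    then have C': "subgraph C G" "connected_graph C" unfolding components_def by blast+
    then obtain v where v: "v \<in> verts C" by (auto simp: connected_graph_def)
    then have "v \<in> ?V" using C' by (auto simp: subgraph_def)
    have "subgraph C (?c v)" using max[OF C' v] .
    moreover have "D = C" if "subgraph D G" "connected_graph D" "subgraph C D" for D
      using C that unfolding components_def by blast
    ultimately have "C = ?c v" using c[OF \<open>v \<in> ?V\<close>] by metis
    then show "C \<in> ?c ` ?V" using \<open>v \<in> ?V\<close> by (rule image_eqI)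
  next
    fix C assume "C \<in> ?c ` ?V"
    then obtain v where v: "v \<in> ?V" "C = ?c v" by auto
    have "D = C" if "subgraph D G" "connected_graph D" "subgraph C D" for D
    proof (rule anti)
      have "v \<in> verts D" using that(3) v comp_of_self[OF v(1)] by (auto simp: subgraph_def)
      then show "subgraph D C" using max[OF that(1,2)] v(2) by simp
    qed (rule that(3))
    then show "C \<in> components G"
      unfolding components_def using c[OF v(1)] by (intro CollectI conjI) (simp_all add: v(2))
  qed
qed

lemma tough_iff_unsplit:
  assumes "simple_graph H"
  shows "tough H \<longleftrightarrow> unsplit (edges H) (verts H) (verts H)"
proof -
  let ?E = "edges H" and ?V = "verts H"
  have key: "finite (components (delete_verts H X)) \<longleftrightarrow>
    (\<exists>R. finite R \<and> (\<forall>u\<in>?V - X. \<exists>r\<in>R. joined ?E (?V - X) r u))" for X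
  proof -
    let ?D = "delete_verts H X"
    have s: "simple_graph ?D"
      unfolding simple_graph_def
    proof
      fix e assume "e \<in> edges ?D"
      then have e: "e \<in> ?E" "e \<inter> X = {}" by (auto simp: delete_verts_def)
      then obtain a b where "a \<in> ?V" "b \<in> ?V" "a \<noteq> b" "e = {a, b}"
        using assms by (fastforce simp: simple_graph_def)
      then show "\<exists>a\<in>verts ?D. \<exists>b\<in>verts ?D. a \<noteq> b \<and> e = {a, b}"
        using e by (auto simp: delete_verts_def)
    qed
    have j: "joined (edges ?D) (?V - X) = joined ?E (?V - X)"
      by (rule joined_edge_cong) (auto simp: delete_verts_def)
    have V: "verts ?D = ?V - X" by (simp add: delete_verts_def)
    let ?C = "comp_of ?E (?V - X)"
    let ?g = "\<lambda>v. \<lparr>verts = ?C v, edges = {e \<in> edges ?D. e \<subseteq> ?C v}\<rparr>"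
    have comps: "components ?D = ?g ` (?V - X)"
      using components_eq[OF s] j V by (simp add: comp_of_def)
    show ?thesis
    proof
      assume "finite (components ?D)"
      \<comment> \<open>A finite image is already the image of a finite subset, so one vertex per
        component can be picked as its representative.\<close>
      then obtain R where R: "R \<subseteq> ?V - X" "finite R" "?g ` (?V - X) = ?g ` R"
        using finite_subset_image[of "?g ` (?V - X)" ?g "?V - X"] unfolding comps by blast
      have "\<exists>r\<in>R. joined ?E (?V - X) r u" if u: "u \<in> ?V - X" for u
      proof -
        have "?g u \<in> ?g ` R" using u R(3) by blast
        then obtain r where r: "r \<in> R" "?C u = ?C r" by auto
        then have "u \<in> ?C r" using comp_of_self[OF u, of ?E] by simp
        then show ?thesis using r by (auto simp: comp_of_def)
      qed
      then show "\<exists>R. finite R \<and> (\<forall>u\<in>?V - X. \<exists>r\<in>R. joined ?E (?V - X) r u)" using R by blast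
    next
      assume "\<exists>R. finite R \<and> (\<forall>u\<in>?V - X. \<exists>r\<in>R. joined ?E (?V - X) r u)"
      then obtain R where R: "finite R" "\<forall>u\<in>?V - X. \<exists>r\<in>R. joined ?E (?V - X) r u" by auto
      have "components ?D \<subseteq> ?g ` R"
      proof
        fix C assume "C \<in> components ?D"
        then obtain u where u: "u \<in> ?V - X" "C = ?g u" unfolding comps by auto
        then obtain r where "r \<in> R" "joined ?E (?V - X) r u" using R by auto
        moreover from this have "C = ?g r" using u comp_of_eq[of ?E "?V - X" r u] by simp
        ultimately show "C \<in> ?g ` R" by blast
      qed
      then show "finite (components ?D)" using R finite_subset by blast
    qed
  qed
  show ?thesis
    unfolding tough_def key unsplit_def Int_absorb
  proof (intro iffI allI impI)
    fix X :: "'a set"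
    assume *: "\<forall>X. finite X \<and> X \<subseteq> ?V \<longrightarrow>
      (\<exists>R. finite R \<and> (\<forall>u\<in>?V - X. \<exists>r\<in>R. joined ?E (?V - X) r u))" and "finite X"
    \<comment> \<open>Toughness only speaks of sets \<open>X\<close> inside the vertex set,
      \<open>unsplit\<close> of arbitrary finite ones; intersecting with \<open>?V\<close> does not
      change what is left.\<close>
    have "?V - X \<inter> ?V = ?V - X" by auto
    then show "\<exists>R. finite R \<and> (\<forall>u\<in>?V - X. \<exists>r\<in>R. joined ?E (?V - X) r u)"
      using *[rule_format, of "X \<inter> ?V"] \<open>finite X\<close> by simp
  qed simp
qed

text \<open>Some finite \<open>X\<close> leaves infinitely many components that meet
  \<open>U\<close>. Each sends an edge to \<open>X\<close>, so by pigeonhole a single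
  \<open>c\<close> in \<open>X\<close> is adjacent to infinitely many of them. The paths
  \<open>q z\<close> together with \<open>c\<close> form a star whose leaves are pairwise separated
  by \<open>X\<close>.\<close>

lemma not_unsplit_fork:
  assumes K: "conn E K" and "\<not> unsplit E K U"
  obtains X c Z q where "finite X" "c \<in> K \<inter> X" "infinite Z" "Z \<subseteq> U"
    "\<And>z. z \<in> Z \<Longrightarrow> path_in E (K - X) (q z) \<and> last (q z) = z \<and> {c, hd (q z)} \<in> E"
    "\<And>z z'. \<lbrakk>z \<in> Z; z' \<in> Z; z \<noteq> z'\<rbrakk> \<Longrightarrow> \<not> joined E (K - X) z z'"
proof -
  obtain X where X: "finite X"
    and X': "\<nexists>R. finite R \<and> (\<forall>u\<in>U \<inter> K - X. \<exists>r\<in>R. joined E (K - X) r u)"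
    using assms(2) unfolding unsplit_def not_all not_imp by (elim exE conjE)
  let ?C = "comp_of E (K - X)"
  have inf: "infinite (?C ` (U \<inter> K - X))"
  proof
    assume "finite (?C ` (U \<inter> K - X))"
    then obtain R where R: "R \<subseteq> U \<inter> K - X" "finite R" "?C ` (U \<inter> K - X) = ?C ` R"
      using finite_subset_image[of "?C ` (U \<inter> K - X)" ?C "U \<inter> K - X"] by auto
    have "\<exists>r\<in>R. joined E (K - X) r u" if u: "u \<in> U \<inter> K - X" for u
    proof -
      have "?C u \<in> ?C ` R" using imageI[OF u, of ?C] R(3) by simp
      then obtain r where r: "r \<in> R" "?C u = ?C r" by auto
      moreover have "u \<in> ?C u" using u by (intro comp_of_self) auto
      ultimately have "u \<in> ?C r" by simp
      then show ?thesis using r(1) by (auto simp: comp_of_def)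
    qed
    then show False using X' R(2) by blast
  qed
  \<comment> \<open>\<open>Z0\<close> contains exactly one vertex of \<open>U\<close> from each
    component that meets \<open>U\<close>.\<close>
  obtain Z0 where Z0: "Z0 \<subseteq> U \<inter> K - X" "inj_on ?C Z0" "?C ` (U \<inter> K - X) = ?C ` Z0"
    using subset_image_inj[of "?C ` (U \<inter> K - X)" ?C "U \<inter> K - X"] by auto
  then have infZ0: "infinite Z0" using inf by auto
  have sep: "\<not> joined E (K - X) z z'" if "z \<in> Z0" "z' \<in> Z0" "z \<noteq> z'" for z z'
  proof
    assume "joined E (K - X) z z'"
    then have "?C z = ?C z'" by (rule comp_of_eq)
    then show False using Z0(2) that by (auto dest: inj_onD)
  qed
  \<comment> \<open>If \<open>X\<close> missed \<open>K\<close>, then \<open>K - X\<close> would be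
    the connected set \<open>K\<close>, contradicting that two vertices of \<open>Z0\<close> are
    separated.\<close>
  have KX: "K \<inter> X \<noteq> {}"
  proof
    assume "K \<inter> X = {}"
    then have "K - X = K" by auto
    obtain z where z: "z \<in> Z0" using infinite_imp_nonempty[OF infZ0] by auto
    have "infinite (Z0 - {z})" using infZ0 by simp
    then obtain z' where z': "z' \<in> Z0" "z' \<noteq> z" using infinite_imp_nonempty by blast
    have "joined E (K - X) z z'" using K Z0(1) z z' \<open>K - X = K\<close> by (auto simp: conn_def)
    then show False using sep[OF z z'(1)] z'(2) by auto
  qed
  have "\<exists>b\<in>K \<inter> X. \<exists>a. joined E (K - X) a z \<and> {b, a} \<in> E" if "z \<in> Z0" for z
  proof -
    have "z \<in> K - X" using that Z0(1) by auto
    then obtain a b where "joined E (K - X) z a" "b \<in> X \<inter> K" "{b, a} \<in> E"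
      by (rule conn_neighbour[OF K _ KX])
    then show ?thesis using joined_sym[of E "K - X" z a] by auto
  qed
  then have "\<exists>b\<in>K \<inter> X. infinite {z \<in> Z0. \<exists>a. joined E (K - X) a z \<and> {b, a} \<in> E}"
    using infZ0 X by (intro pigeonhole_infinite_rel) auto
  then obtain c where c: "c \<in> K \<inter> X" "infinite {z \<in> Z0. \<exists>a. joined E (K - X) a z \<and> {c, a} \<in> E}"
    by blast
  let ?Z = "{z \<in> Z0. \<exists>a. joined E (K - X) a z \<and> {c, a} \<in> E}"
  have "\<exists>q. path_in E (K - X) q \<and> last q = z \<and> {c, hd q} \<in> E" if z: "z \<in> ?Z" for z
  proof -
    obtain a where a: "joined E (K - X) a z" "{c, a} \<in> E" using z by auto
    obtain q where "path_in E (K - X) q" "hd q = a" "last q = z" using joined_path[OF a(1)] by blast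
    then show ?thesis using a by auto
  qed
  then have "\<exists>q. \<forall>z\<in>?Z. path_in E (K - X) (q z) \<and> last (q z) = z \<and> {c, hd (q z)} \<in> E"
    by (intro bchoice ballI)
  then obtain q where q: "\<forall>z\<in>?Z. path_in E (K - X) (q z) \<and> last (q z) = z \<and> {c, hd (q z)} \<in> E" ..
  show ?thesis
  proof (rule that[OF X c(1) c(2)])
    show "?Z \<subseteq> U" using Z0(1) by blast
    show "path_in E (K - X) (q z) \<and> last (q z) = z \<and> {c, hd (q z)} \<in> E" if "z \<in> ?Z" for z
      using q that by (rule bspec)
    show "\<not> joined E (K - X) z z'" if "z \<in> ?Z" "z' \<in> ?Z" "z \<noteq> z'" for z z'
      using sep that by simp
  qed
qed

lemma fork_paths_disjoint:
  assumes "path_in E A p" "path_in E A q" "\<not> joined E A (last p) (last q)"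
  shows "set p \<inter> set q = {}"
proof (rule ccontr)
  assume "set p \<inter> set q \<noteq> {}"
  then obtain y where y: "y \<in> set p" "y \<in> set q" by auto
  have j: "joined E A x (last r)" if "path_in E A r" "x \<in> set r" for r x
  proof (rule conn_joined[OF path_in_conn[OF that(1)] that(2)])
    show "last r \<in> set r" "set r \<subseteq> A" using that by (auto simp: path_in_def is_path_def)
  qed
  have "joined E A (last p) (last q)"
    using joined_trans[OF joined_sym[OF j[OF assms(1) y(1)]] j[OF assms(2) y(2)]] .
  then show False using assms(3) by simp
qed

text \<open>Finitely many components of \<open>A - Y\<close> cover the infinite set
  \<open>A \<inter> U\<close> up to \<open>Y\<close>, so one of them contains infinitely many
  vertices of \<open>U\<close>. It inherits being unsplit, because deleting \<open>X\<close> from it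
  is controlled by deleting \<open>Y \<union> X\<close> from \<open>A\<close>.\<close>

lemma unsplit_comp_of:
  assumes A: "unsplit E A U" and inf: "infinite (A \<inter> U)" and Y: "finite Y"
  obtains y where "unsplit E (comp_of E (A - Y) y) U" "infinite (comp_of E (A - Y) y \<inter> U)"
proof -
  obtain R where R: "finite R" "\<And>u. u \<in> U \<inter> A - Y \<Longrightarrow> \<exists>r\<in>R. joined E (A - Y) r u"
    using A[unfolded unsplit_def, rule_format, OF Y] by auto
  have "A \<inter> U \<subseteq> Y \<union> (\<Union>r\<in>R. comp_of E (A - Y) r \<inter> U)"
  proof
    fix u assume "u \<in> A \<inter> U"
    then show "u \<in> Y \<union> (\<Union>r\<in>R. comp_of E (A - Y) r \<inter> U)"
      using R(2)[of u] by (auto simp: comp_of_def)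
  qed
  then have "infinite (Y \<union> (\<Union>r\<in>R. comp_of E (A - Y) r \<inter> U))"
    using inf by (rule infinite_super)
  then obtain y where y: "infinite (comp_of E (A - Y) y \<inter> U)"
    using Y R(1) unfolding finite_Un finite_UN[OF R(1)] by blast
  let ?C = "comp_of E (A - Y) y"
  have "unsplit E ?C U"
    unfolding unsplit_def
  proof (intro allI impI)
    fix X :: "'a set" assume "finite X"
    then obtain R where R: "finite R" "\<And>u. u \<in> U \<inter> A - (Y \<union> X) \<Longrightarrow> \<exists>r\<in>R. joined E (A - (Y \<union> X)) r u"
      using A[unfolded unsplit_def, rule_format, of "Y \<union> X"] Y by auto
    have "\<exists>r\<in>R. joined E (?C - X) r u" if u: "u \<in> U \<inter> ?C - X" for u
    proof -
      have "u \<in> U \<inter> A - (Y \<union> X)" using u comp_of_subset[of E "A - Y" y] by auto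
      then obtain r where r: "r \<in> R" "joined E (A - (Y \<union> X)) r u" using R(2) by blast
      have "A - (Y \<union> X) = A - Y - X" by auto
      then have "joined E (A - Y - X) u r" using joined_sym[OF r(2)] by simp
      then have "joined E (?C - X) u r" using u by (intro joined_comp_of) auto
      then show ?thesis using r(1) joined_sym[of E "?C - X" u r] by auto
    qed
    then show "\<exists>R. finite R \<and> (\<forall>u\<in>U \<inter> ?C - X. \<exists>r\<in>R. joined E (?C - X) r u)" using R(1) by blast
  qed
  then show ?thesis using that y by blast
qed

text \<open>Inside the current region take a path to a vertex of \<open>U\<close>, delete it, and
  continue in a component of the rest that still contains infinitely many vertices of
  \<open>U\<close>. By connectedness this component is adjacent to some vertex \<open>w n\<close> of
  the deleted path, not necessarily its end. The chain serves both for combs and for enlarging tough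
  sets.\<close>

lemma unsplit_chain:
  assumes A: "unsplit E A U" and inf: "infinite (A \<inter> U)"
  obtains p :: "nat \<Rightarrow> 'a list" and w where
    "\<And>n. path_in E A (p n)" "\<And>n. last (p n) \<in> U" "\<And>n. w n \<in> set (p n)"
    "\<And>n. {w n, hd (p (Suc n))} \<in> E" "\<And>m n. m \<noteq> n \<Longrightarrow> set (p m) \<inter> set (p n) = {}"
proof -
  \<comment> \<open>A state is a connected region \<open>B\<close> with infinitely many vertices of
    \<open>U\<close> and a start vertex \<open>v\<close> for the next path. The relation
    \<open>Q\<close> says that the next region avoids a path from \<open>v\<close> and that the next
    start vertex is adjacent to that path.\<close>
  define I where "I = (\<lambda>(B, v). B \<subseteq> A \<and> conn E B \<and> unsplit E B U \<and> infinite (B \<inter> U) \<and> v \<in> B)"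
  define Q where "Q = (\<lambda>(B, v) (B', v'). \<exists>p w. path_in E B p \<and> hd p = v \<and> last p \<in> U \<and>
    w \<in> set p \<and> {w, v'} \<in> E \<and> B' \<subseteq> B - set p)"
  have "\<exists>f. \<forall>n. I (f n) \<and> Q (f n) (f (Suc n))"
  proof (rule dependent_nat_choice[where P = "\<lambda>_. I" and Q = "\<lambda>_. Q"])
    \<comment> \<open>Deleting the empty set replaces \<open>A\<close>, which need not be connected,
      by one of its components.\<close>
    obtain y where y: "unsplit E (comp_of E (A - {}) y) U" "infinite (comp_of E (A - {}) y \<inter> U)"
      using unsplit_comp_of[OF A inf, of "{}"] by auto
    then obtain v where "v \<in> comp_of E (A - {}) y" using infinite_imp_nonempty[OF y(2)] by auto
    then have "I (comp_of E (A - {}) y, v)"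
      using y comp_of_subset[of E A y] conn_comp_of[of E A y] by (simp add: I_def)
    then show "\<exists>x. I x" by blast
  next
    fix x :: "'a set \<times> 'a" and n :: nat assume "I x"
    obtain B v where x: "x = (B, v)" by (cases x)
    have B: "B \<subseteq> A" "conn E B" "unsplit E B U" "infinite (B \<inter> U)" "v \<in> B"
      using \<open>I x\<close> by (auto simp: I_def x)
    obtain u where u: "u \<in> B \<inter> U" using infinite_imp_nonempty[OF B(4)] by auto
    then have "joined E B v u" using B by (auto simp: conn_def)
    then obtain p where p: "path_in E B p" "hd p = v" "last p = u" by (rule joined_path)
    obtain y where y: "unsplit E (comp_of E (B - set p) y) U" "infinite (comp_of E (B - set p) y \<inter> U)"
      using unsplit_comp_of[OF B(3,4), of "set p"] by auto
    let ?B = "comp_of E (B - set p) y"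
    obtain z where "z \<in> ?B" using infinite_imp_nonempty[OF y(2)] by auto
    then have "y \<in> B - set p" using joined_in(1)[of E "B - set p" y z] by (simp add: comp_of_def)
    moreover have "B \<inter> set p \<noteq> {}"
      using p(1) hd_in_set[of p] unfolding path_in_def is_path_def by blast
    ultimately obtain a b where ab: "joined E (B - set p) y a" "b \<in> set p \<inter> B" "{b, a} \<in> E"
      using conn_neighbour[OF B(2)] by blast
    have "?B \<subseteq> B - set p" by (rule comp_of_subset)
    moreover have "a \<in> ?B" using ab(1) by (simp add: comp_of_def)
    ultimately have "I (?B, a)" "Q x (?B, a)"
      using B(1) y ab conn_comp_of[of E "B - set p" y] p u by (auto simp: I_def Q_def x)
    then show "\<exists>y. I y \<and> Q x y" by blast
  qed
  then obtain f where f: "\<And>n. I (f n)" "\<And>n. Q (f n) (f (Suc n))" by blast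
  define B where "B n = fst (f n)" for n
  define v where "v n = snd (f n)" for n
  have fe: "f n = (B n, v n)" for n by (simp add: B_def v_def)
  have "\<forall>n. \<exists>p w. path_in E (B n) p \<and> hd p = v n \<and> last p \<in> U \<and>
    w \<in> set p \<and> {w, v (Suc n)} \<in> E \<and> B (Suc n) \<subseteq> B n - set p"
    using f(2) by (simp add: Q_def fe)
  then obtain p w where "\<forall>n. path_in E (B n) (p n) \<and> hd (p n) = v n \<and> last (p n) \<in> U \<and>
    w n \<in> set (p n) \<and> {w n, v (Suc n)} \<in> E \<and> B (Suc n) \<subseteq> B n - set (p n)"
    unfolding choice_iff by (elim exE)
  then have pw: "path_in E (B n) (p n)" "hd (p n) = v n" "last (p n) \<in> U"
    "w n \<in> set (p n)" "{w n, v (Suc n)} \<in> E" "B (Suc n) \<subseteq> B n - set (p n)" for n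
    by auto
  have BA: "B n \<subseteq> A" for n using f(1)[of n] by (simp add: I_def fe)
  have anti: "B n \<subseteq> B m" if "m \<le> n" for m n
  proof (rule lift_Suc_antimono_le[OF _ that])
    show "B (Suc n) \<subseteq> B n" for n using pw(6)[of n] by blast
  qed
  \<comment> \<open>The later path lies in a region contained in \<open>B (Suc m)\<close>, from
    which the earlier path has been removed.\<close>
  have disj: "set (p m) \<inter> set (p n) = {}" if "m < n" for m n
  proof -
    have "B n \<subseteq> B (Suc m)" using that by (intro anti) simp
    moreover have "set (p n) \<subseteq> B n" using pw(1)[of n] by (simp add: path_in_def)
    moreover have "B (Suc m) \<inter> set (p m) = {}" using pw(6)[of m] by blast
    ultimately show ?thesis by blast
  qed
  show ?thesis
  proof (rule that[of p w])
    show "path_in E A (p n)" for n using path_in_mono[OF pw(1) BA] .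
    show "set (p m) \<inter> set (p n) = {}" if "m \<noteq> n" for m n
      using disj[of m n] disj[of n m] that by (cases m n rule: linorder_cases) auto
    show "last (p n) \<in> U" "w n \<in> set (p n)" "{w n, hd (p (Suc n))} \<in> E" for n
      using pw(3)[of n] pw(4)[of n] pw(5)[of n] pw(2)[of "Suc n"] by simp_all
  qed
qed

section \<open>Combs and stars\<close>

lemma subgraph_graph_Union:
  assumes "\<And>A. A \<in> \<G> \<Longrightarrow> subgraph A H"
  shows "subgraph (graph_Union \<G>) H"
proof -
  have "\<exists>u\<in>\<Union> (verts ` \<G>). \<exists>v\<in>\<Union> (verts ` \<G>). u \<noteq> v \<and> e = {u, v}"
    if e: "e \<in> \<Union> (edges ` \<G>)" for e
  proof -
    obtain A where A: "A \<in> \<G>" "e \<in> edges A" using e by auto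
    then have "\<exists>u\<in>verts A. \<exists>v\<in>verts A. u \<noteq> v \<and> e = {u, v}"
      using assms by (simp add: subgraph_def simple_graph_def)
    then show ?thesis using A(1) by blast
  qed
  then have "simple_graph (graph_Union \<G>)"
    by (simp add: simple_graph_def graph_Union_def)
  moreover have "verts A \<subseteq> verts H" "edges A \<subseteq> edges H" if "A \<in> \<G>" for A
    using assms[OF that] by (simp_all add: subgraph_def)
  ultimately show ?thesis unfolding subgraph_def by (auto simp: graph_Union_def)
qed

text \<open>The ray runs through the initial segment \<open>s n\<close> of each path \<open>p n\<close> and leaves it at \<open>w n\<close>;
  the remaining segments \<open>t n\<close> are the paths to the teeth.\<close>

lemma unsplit_comb:
  assumes H: "simple_graph H" and "unsplit (edges H) (verts H) U" and "infinite (verts H \<inter> U)"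
  obtains C T where "comb C T" "subgraph C H" "infinite T" "T \<subseteq> U"
proof -
  let ?E = "edges H" and ?V = "verts H"
  obtain p :: "nat \<Rightarrow> 'a list" and w where p: "\<And>n. path_in ?E ?V (p n)"
    and lastU: "\<And>n. last (p n) \<in> U" and w: "\<And>n. w n \<in> set (p n)"
    and link: "\<And>n. {w n, hd (p (Suc n))} \<in> ?E"
    and disj: "\<And>m n. m \<noteq> n \<Longrightarrow> set (p m) \<inter> set (p n) = {}"
    using unsplit_chain[OF assms(2,3)] by metis
  have "\<forall>n. \<exists>a b. p n = a @ w n # b" using w by (intro allI split_list)
  then obtain a b where ab: "\<forall>n. p n = a n @ w n # b n" unfolding choice_iff by (elim exE)
  define s where "s n = a n @ [w n]" for n
  define t where "t n = w n # b n" for n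
  have ps: "p n = s n @ b n" and pt: "p n = a n @ t n" for n using ab by (simp_all add: s_def t_def)
  have dist: "distinct (p n)" for n using p[of n] by (simp add: path_in_def is_path_def)
  have s_path: "path_in ?E ?V (s n)" for n
    using path_in_append(1)[of ?E ?V "s n" "b n"] p[of n] ps[of n] by (simp add: s_def)
  have t_path: "path_in ?E ?V (t n)" for n
    using path_in_append(2)[of ?E ?V "a n" "t n"] p[of n] pt[of n] by (simp add: t_def)
  have s_sub: "set (s n) \<subseteq> set (p n)" for n by (simp add: ps)
  have t_sub: "set (t n) \<subseteq> set (p n)" for n by (simp add: pt)
  have hd_s: "hd (s n) = hd (p n)" for n using ab by (simp add: s_def hd_append)
  have last_t: "last (t n) = last (p n)" for n using ab by (simp add: t_def)
  have st: "set (t n) \<inter> set (s n) = {w n}" for n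
    using dist[of n] ab by (auto simp: s_def t_def)
  \<comment> \<open>\<open>L n\<close> is the part of the ray formed by the first \<open>n\<close>
    segments. These lists are prefixes of one another and grow without bound, as every
    \<open>s n\<close> contains \<open>w n\<close>.\<close>
  define L where "L n = concat (map s [0..<n])" for n
  have L_Suc: "L (Suc n) = L n @ s n" for n by (simp add: L_def)
  have set_L: "set (L n) = (\<Union>m<n. set (s m))" for n by (auto simp: L_def)
  have L_add: "\<exists>ys. L (m + k) = L m @ ys" for m k by (induction k) (auto simp: L_Suc)
  have len_L: "n \<le> length (L n)" for n
    by (induction n) (auto simp: L_Suc s_def)
  have L_dist: "distinct (L n)" for n
  proof (induction n)
    case (Suc n)
    have "set (s m) \<inter> set (s n) = {}" if "m < n" for m
      using disj[of m n] s_sub[of m] s_sub[of n] that by auto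
    then show ?case using Suc dist[of n] ps[of n] by (auto simp: L_Suc set_L)
  qed (simp add: L_def)
  \<comment> \<open>The induction also records that the last entry is \<open>w m\<close>, since the
    edge to the next segment starts there.\<close>
  have L_succ: "successively (\<lambda>x y. {x, y} \<in> ?E) (L n) \<and> (\<forall>m. n = Suc m \<longrightarrow> last (L n) = w m)" for n
  proof (induction n)
    case (Suc n)
    have "{last (L n), hd (s n)} \<in> ?E" if "L n \<noteq> []"
    proof (cases n)
      case (Suc m)
      then show ?thesis using Suc.IH link[of m] hd_s[of n] by simp
    qed (use that in \<open>simp add: L_def\<close>)
    then show ?case using Suc.IH s_path[of n]
      by (auto simp: L_Suc successively_append_iff path_in_def) (simp_all add: s_def)
  qed (simp add: L_def)
  \<comment> \<open>\<open>L (Suc i)\<close> has at least \<open>Suc i\<close> entries, so index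
    \<open>i\<close> is valid; any longer prefix gives the same entry.\<close>
  define r where "r i = L (Suc i) ! i" for i
  have r_L: "r i = L n ! i" if "i < n" for i n
  proof -
    have "Suc i \<le> n" using that by simp
    then obtain k where "n = Suc i + k" using le_Suc_ex by blast
    then obtain ys where "L n = L (Suc i) @ ys" using L_add[of "Suc i" k] by auto
    moreover have "i < length (L (Suc i))" using len_L[of "Suc i"] by simp
    ultimately show ?thesis by (simp add: r_def nth_append)
  qed
  have inj: "inj r"
  proof (rule injI)
    fix i j assume "r i = r j"
    let ?n = "Suc (max i j)"
    have "L ?n ! i = L ?n ! j" using r_L[of i ?n] r_L[of j ?n] \<open>r i = r j\<close> by simp
    moreover have "i < length (L ?n)" "j < length (L ?n)" using len_L[of ?n] by linarith+
    ultimately show "i = j" using L_dist[of ?n] by (simp add: nth_eq_iff_index_eq)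
  qed
  have range_r: "range r = (\<Union>n. set (s n))"
  proof (intro set_eqI iffI)
    fix x assume "x \<in> range r"
    then obtain i where "x = L (Suc i) ! i" by (auto simp: r_def)
    then have "x \<in> set (L (Suc i))" using len_L[of "Suc i"] by simp
    then show "x \<in> (\<Union>n. set (s n))" by (auto simp: set_L)
  next
    fix x assume "x \<in> (\<Union>n. set (s n))"
    then obtain n where "x \<in> set (s n)" by auto
    then have "x \<in> set (L (Suc n))" by (auto simp: set_L)
    then obtain i where i: "i < length (L (Suc n))" "L (Suc n) ! i = x" by (auto simp: in_set_conv_nth)
    obtain ys where "L (Suc n + i) = L (Suc n) @ ys" using L_add[of "Suc n" i] by auto
    then have "r i = x" using r_L[of i "Suc n + i"] i by (simp add: nth_append)
    then show "x \<in> range r" by auto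
  qed
  have r_edge: "{r i, r (Suc i)} \<in> ?E" for i
  proof -
    let ?n = "Suc (Suc i)"
    have "{L ?n ! i, L ?n ! Suc i} \<in> ?E"
      using L_succ[of ?n] len_L[of ?n] by (simp add: successively_conv_nth)
    then show ?thesis using r_L[of i ?n] r_L[of "Suc i" ?n] by simp
  qed
  \<comment> \<open>Segments of different paths are disjoint, so \<open>t n\<close> can meet the ray
    only in \<open>s n\<close>, where it shares just \<open>w n\<close>.\<close>
  have tr: "set (t n) \<inter> range r = {w n}" for n
  proof -
    have "set (t n) \<inter> set (s m) = {}" if "m \<noteq> n" for m
      using disj[of m n] that s_sub[of m] t_sub[of n] by auto
    then have "set (t n) \<inter> range r = set (t n) \<inter> set (s n)" unfolding range_r by fastforce
    then show ?thesis using st by simp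
  qed
  have t_disj: "set (t m) \<inter> set (t n) = {}" if "m \<noteq> n" for m n
    using disj[OF that] t_sub[of m] t_sub[of n] by auto
  have inj_last: "inj (\<lambda>n. last (t n))"
  proof (rule injI)
    fix m n assume eq: "last (t m) = last (t n)"
    have "last (t k) \<in> set (t k)" for k by (rule last_in_set) (simp add: t_def)
    then have "last (t m) \<in> set (t m) \<inter> set (t n)" using eq by (metis IntI)
    then show "m = n" using t_disj[of m n] by blast
  qed
  let ?P = "range t"
  let ?C = "graph_Union (insert (ray_graph r) (path_graph ` ?P))"
  have lasts: "last ` ?P = range (\<lambda>n. last (t n))" by auto
  have infT: "infinite (last ` ?P)" using inj_last unfolding lasts by (simp add: finite_image_iff)
  then have infP: "infinite ?P" by blast
  have "comb ?C (last ` ?P)"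
    unfolding comb_def
  proof (intro exI conjI ballI impI)
    show "is_path q" if "q \<in> ?P" for q using that t_path by (auto simp: path_in_def)
    show "set q \<inter> range r = {hd q}" if q: "q \<in> ?P" for q
    proof -
      obtain n where "q = t n" using q by auto
      then show ?thesis using tr[of n] by (simp add: t_def)
    qed
    show "set q \<inter> set q' = {}" if q: "q \<in> ?P" "q' \<in> ?P" "q \<noteq> q'" for q q'
    proof -
      obtain m n where "q = t m" "q' = t n" using q by auto
      then show ?thesis using t_disj[of m n] q(3) by auto
    qed
  qed (use inj infP in simp_all)
  moreover have "subgraph ?C H"
  proof (rule subgraph_graph_Union)
    fix A assume "A \<in> insert (ray_graph r) (path_graph ` ?P)"
    then consider "A = ray_graph r" | n where "A = path_graph (t n)" by auto
    then show "subgraph A H"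
    proof cases
      case 1
      have "set (s n) \<subseteq> ?V" for n using s_path[of n] by (simp add: path_in_def)
      then have "range r \<subseteq> ?V" unfolding range_r by auto
      moreover have "r i \<noteq> r (Suc i)" for i using inj by (auto dest: injD)
      ultimately show ?thesis
        using r_edge unfolding 1 subgraph_def simple_graph_def ray_graph_def by fastforce
    next
      case 2
      then show ?thesis using t_path[of n] path_graph_subgraph[of "t n" H] by (simp add: path_in_def)
    qed
  qed
  moreover have "last ` ?P \<subseteq> U" using lastU last_t by auto
  ultimately show ?thesis using that infT by blast
qed

section \<open>Leaves of stars, teeth of combs, and domination\<close>

lemma unsplit_subset:
  assumes "unsplit E A U" "U' \<subseteq> U"
  shows "unsplit E A U'"
  unfolding unsplit_def
proof (intro allI impI)
  fix X :: "'a set" assume "finite X"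
  then obtain R where "finite R" "\<forall>u\<in>U \<inter> A - X. \<exists>r\<in>R. joined E (A - X) r u"
    using assms(1) unfolding unsplit_def by auto
  then show "\<exists>R. finite R \<and> (\<forall>u\<in>U' \<inter> A - X. \<exists>r\<in>R. joined E (A - X) r u)"
    using assms(2) by (intro exI[of _ R]) auto
qed

text \<open>Leaves are defined by degree one in the union, so it has to be checked that the other
  paths add no edges at a vertex different from \<open>c\<close>, and that \<open>c\<close> itself
  has at least two edges.\<close>

lemma star_leaves:
  assumes inf: "infinite P"
    and path: "\<And>p. p \<in> P \<Longrightarrow> is_path p \<and> hd p = c \<and> length p \<ge> 2"
    and disj: "\<And>p q. \<lbrakk>p \<in> P; q \<in> P; p \<noteq> q\<rbrakk> \<Longrightarrow> set p \<inter> set q = {c}"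
  shows "leaves (graph_Union (path_graph ` P)) = last ` P"
proof -
  let ?S = "graph_Union (path_graph ` P)"
  have verts: "verts ?S = (\<Union>p\<in>P. set p)" by (simp add: graph_Union_def path_graph_def)
  have edges: "e \<in> edges ?S \<longleftrightarrow> (\<exists>p\<in>P. \<exists>i. Suc i < length p \<and> e = {p ! i, p ! Suc i})" for e
    by (auto simp: graph_Union_def path_graph_def)
  have p0: "p ! 0 = c" "p \<noteq> []" "distinct p" "2 \<le> length p" if "p \<in> P" for p
    using path[OF that] by (auto simp: is_path_def hd_conv_nth)
  \<comment> \<open>A vertex at a position \<open>k > 0\<close> differs from \<open>c\<close> and so
    lies on no other path. Its edges are the one before it and, unless it is the last vertex, the
    one after it.\<close>
  have at: "e \<in> edges ?S \<and> p ! k \<in> e \<longleftrightarrow>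
      (Suc k < length p \<and> e = {p ! k, p ! Suc k}) \<or> e = {p ! (k - 1), p ! k}"
    if p: "p \<in> P" and k: "0 < k" "k < length p" for p k e
  proof
    assume "e \<in> edges ?S \<and> p ! k \<in> e"
    then obtain q i where q: "q \<in> P" "Suc i < length q" "e = {q ! i, q ! Suc i}" "p ! k \<in> e"
      unfolding edges by blast
    have "p ! k \<noteq> p ! 0" using nth_eq_iff_index_eq[OF p0(3)[OF p] k(2), of 0] k p0(2)[OF p] by simp
    then have "p ! k \<noteq> c" using p0(1)[OF p] by simp
    moreover have "p ! k \<in> set p \<inter> set q" using q k by auto
    ultimately have "q = p" using disj[OF p q(1)] by auto
    then have "i = k \<or> Suc i = k"
      using q p0(3)[OF p] k by (auto simp: nth_eq_iff_index_eq)
    then show "(Suc k < length p \<and> e = {p ! k, p ! Suc k}) \<or> e = {p ! (k - 1), p ! k}"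
      using q \<open>q = p\<close> by auto
  next
    assume "(Suc k < length p \<and> e = {p ! k, p ! Suc k}) \<or> e = {p ! (k - 1), p ! k}"
    then show "e \<in> edges ?S \<and> p ! k \<in> e"
    proof
      assume "Suc k < length p \<and> e = {p ! k, p ! Suc k}"
      then show ?thesis using p unfolding edges by blast
    next
      assume e: "e = {p ! (k - 1), p ! k}"
      have "Suc (k - 1) < length p" "e = {p ! (k - 1), p ! Suc (k - 1)}" using k e by simp_all
      then show ?thesis using p e unfolding edges by blast
    qed
  qed
  have c_not: "c \<notin> leaves ?S"
  proof
    assume "c \<in> leaves ?S"
    then have ex1: "\<exists>!e. e \<in> edges ?S \<and> c \<in> e" by (simp add: leaves_def)
    obtain p where p: "p \<in> P" using infinite_imp_nonempty[OF inf] by auto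
    have "infinite (P - {p})" using inf by simp
    then obtain q where q: "q \<in> P" "q \<noteq> p" using infinite_imp_nonempty by blast
    have e: "{c, s ! Suc 0} \<in> edges ?S" if "s \<in> P" for s
      using p0[OF that] that unfolding edges by (intro bexI[of _ s] exI[of _ 0]) auto
    \<comment> \<open>Two different paths have different second vertices, so a unique edge at the
      centre is impossible.\<close>
    have "{c, p ! Suc 0} = {c, q ! Suc 0}" using ex1 e[OF p] e[OF q(1)] by blast
    then have "p ! Suc 0 = q ! Suc 0" by (auto simp: doubleton_eq_iff)
    moreover have "p ! Suc 0 \<in> set p" "q ! Suc 0 \<in> set q"
      using p0(4)[OF p] p0(4)[OF q(1)] by auto
    ultimately have "p ! Suc 0 = c" using disj[OF p q(1)] q(2) by auto
    then have "p ! Suc 0 = p ! 0" using p0(1)[OF p] by simp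
    then show False using p0[OF p] by (subst (asm) nth_eq_iff_index_eq) auto
  qed
  show ?thesis
  proof (intro set_eqI iffI)
    fix v assume v: "v \<in> leaves ?S"
    then obtain p where p: "p \<in> P" "v \<in> set p" by (auto simp: leaves_def verts)
    then obtain k where k: "k < length p" "v = p ! k" by (auto simp: in_set_conv_nth)
    have "k \<noteq> 0"
    proof
      assume "k = 0"
      then have "v = c" using k p0(1)[OF p(1)] by simp
      then show False using v c_not by simp
    qed
    have "\<not> Suc k < length p"
    proof
      assume S: "Suc k < length p"
      have "\<exists>!e. e \<in> edges ?S \<and> v \<in> e" using v by (simp add: leaves_def)
      then have "{p ! k, p ! Suc k} = {p ! (k - 1), p ! k}"
        using at[OF p(1) _ k(1)] \<open>k \<noteq> 0\<close> S unfolding k(2) by blast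
      then have "p ! Suc k = p ! (k - 1)" by (auto simp: doubleton_eq_iff)
      then show False using p0(3)[OF p(1)] S by (simp add: nth_eq_iff_index_eq)
    qed
    then have "k = length p - 1" using k by simp
    then have "v = last p" using k p0(2)[OF p(1)] by (simp add: last_conv_nth)
    then show "v \<in> last ` P" using p by blast
  next
    fix v assume "v \<in> last ` P"
    then obtain p where p: "p \<in> P" "v = last p" by auto
    let ?k = "length p - 1"
    have v: "v = p ! ?k" using p p0(2)[OF p(1)] by (simp add: last_conv_nth)
    have k: "0 < ?k" "?k < length p" "\<not> Suc ?k < length p" using p0(4)[OF p(1)] by auto
    have "e \<in> edges ?S \<and> v \<in> e \<longleftrightarrow> e = {p ! (?k - 1), p ! ?k}" for e
      unfolding v using at[OF p(1) k(1,2)] k(3) by simp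
    then have "\<exists>!e. e \<in> edges ?S \<and> v \<in> e" by simp
    moreover have "v \<in> verts ?S" using p last_in_set[OF p0(2)[OF p(1)]] unfolding verts by blast
    ultimately show "v \<in> leaves ?S" by (simp add: leaves_def)
  qed
qed

text \<open>Picking an element of \<open>Q i \<inter> X\<close> for each such \<open>i\<close> is
  injective by disjointness.\<close>

lemma finite_disjoint_meeting:
  assumes "finite X" and disj: "\<And>i j. \<lbrakk>i \<in> I; j \<in> I; i \<noteq> j\<rbrakk> \<Longrightarrow> Q i \<inter> Q j = {}"
  shows "finite {i \<in> I. Q i \<inter> X \<noteq> {}}"
proof -
  let ?J = "{i \<in> I. Q i \<inter> X \<noteq> {}}"
  have "\<exists>f. \<forall>i\<in>?J. f i \<in> Q i \<inter> X" by (intro bchoice) auto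
  then obtain f where f: "\<forall>i\<in>?J. f i \<in> Q i \<inter> X" ..
  have "inj_on f ?J"
  proof (rule inj_onI)
    fix i j assume ij: "i \<in> ?J" "j \<in> ?J" "f i = f j"
    then have "f i \<in> Q i \<inter> Q j" using f by fastforce
    then show "i = j" using disj[of i j] ij by blast
  qed
  moreover have "f ` ?J \<subseteq> X" using f by blast
  ultimately show ?thesis using assms(1) inj_on_finite by blast
qed

text \<open>A finite \<open>X\<close> meets only an initial part of the ray and finitely many of the
  disjoint paths. The remaining teeth are therefore all joined to one tail of the ray, and two of
  them lie in \<open>Z\<close>.\<close>

lemma comb_teeth_joined:
  assumes "comb C T" "subgraph C G" "finite X" "infinite (Z \<inter> T)"
  obtains x y where "x \<in> Z" "y \<in> Z" "x \<noteq> y" "joined (edges G) (verts G - X) x y"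
proof -
  let ?E = "edges G" and ?V = "verts G"
  obtain r P where r: "inj r" and P': "\<forall>p\<in>P. is_path p \<and> set p \<inter> range r = {hd p}"
    and disj': "\<forall>p\<in>P. \<forall>q\<in>P. p \<noteq> q \<longrightarrow> set p \<inter> set q = {}"
    and C: "C = graph_Union (insert (ray_graph r) (path_graph ` P))" and T: "T = last ` P"
    using assms(1) unfolding comb_def by (elim exE conjE)
  have P: "is_path p \<and> set p \<inter> range r = {hd p}" if "p \<in> P" for p
    using P' that by (rule bspec)
  have disj: "set p \<inter> set q = {}" if "p \<in> P" "q \<in> P" "p \<noteq> q" for p q
    using disj' that by simp
  have rV: "r i \<in> ?V" and rE: "{r i, r (Suc i)} \<in> ?E" for i
    using assms(2) by (auto simp: C subgraph_def graph_Union_def ray_graph_def)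
  have P_path: "path_in ?E ?V p" if p: "p \<in> P" for p
  proof -
    have "verts (path_graph p) \<subseteq> ?V" "edges (path_graph p) \<subseteq> ?E"
      using assms(2) p by (auto simp: C subgraph_def graph_Union_def)
    then have "set p \<subseteq> ?V" "\<And>i. Suc i < length p \<Longrightarrow> {p ! i, p ! Suc i} \<in> ?E"
      by (auto simp: path_graph_def)
    then show ?thesis using P[OF p] by (simp add: path_in_def successively_conv_nth)
  qed
  have "finite (r -` X)" using assms(3) r by (rule finite_vimageI)
  then obtain N where N: "\<forall>i\<in>r -` X. i < N" using finite_nat_set_iff_bounded by blast
  \<comment> \<open>Vertices of the ray before \<open>r N\<close> are added to \<open>X\<close>, so
    that a path avoiding \<open>?Y\<close> also starts on the tail.\<close>
  let ?Y = "X \<union> r ` {..<N}"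
  let ?P = "{p \<in> P. last p \<in> Z}"
  have "Z \<inter> T \<subseteq> last ` ?P" by (auto simp: T)
  then have "infinite ?P" using assms(4) finite_subset[of "Z \<inter> T" "last ` ?P"] by blast
  moreover have "finite {p \<in> P. set p \<inter> ?Y \<noteq> {}}"
    using assms(3) disj by (intro finite_disjoint_meeting) auto
  ultimately have inf: "infinite (?P - {p \<in> P. set p \<inter> ?Y \<noteq> {}})" by simp
  then obtain p where p: "p \<in> ?P - {p \<in> P. set p \<inter> ?Y \<noteq> {}}"
    using infinite_imp_nonempty by blast
  have "infinite (?P - {p \<in> P. set p \<inter> ?Y \<noteq> {}} - {p})" using inf by simp
  then obtain q where q: "q \<in> ?P - {p \<in> P. set p \<inter> ?Y \<noteq> {}}" "q \<noteq> p"
    using infinite_imp_nonempty by blast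
  have tail: "joined ?E (?V - X) (r N) (r i)" if "N \<le> i" for i
    using that
  proof (induction i rule: dec_induct)
    case base
    have "r N \<notin> X" using N by auto
    then show ?case using rV[of N] by (intro joined_refl) simp
  next
    case (step i)
    have "r j \<notin> X" if "N \<le> j" for j
    proof
      assume "r j \<in> X"
      then have "j < N" using N by simp
      then show False using that by simp
    qed
    then have "r i \<notin> X" "r (Suc i) \<notin> X" using step(1) by simp_all
    then have "joined ?E (?V - X) (r i) (r (Suc i))" using rV rE by (intro joined_edge) auto
    with step.IH show ?case by (rule joined_trans)
  qed
  have tooth: "joined ?E (?V - X) (r N) (last s)"
    if s: "s \<in> ?P - {p \<in> P. set p \<inter> ?Y \<noteq> {}}" for s
  proof -
    have sP: "s \<in> P" "set s \<inter> X = {}" "set s \<inter> r ` {..<N} = {}" using s by auto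
    have "hd s \<in> range r" "hd s \<in> set s" "s \<noteq> []" using P[OF sP(1)] by (auto simp: is_path_def)
    then obtain i where i: "hd s = r i" by auto
    then have "N \<le> i" using sP(3) \<open>hd s \<in> set s\<close> by (metis disjoint_iff image_eqI lessThan_iff not_le)
    then have "joined ?E (?V - X) (r N) (hd s)" using tail i by simp
    moreover have "joined ?E (?V - X) (hd s) (last s)"
    proof (rule joined_mono)
      show "joined ?E (set s) (hd s) (last s)"
        using path_in_joined[OF P_path[OF sP(1)]] \<open>s \<noteq> []\<close> by simp
      show "set s \<subseteq> ?V - X" using P_path[OF sP(1)] sP(2) by (auto simp: path_in_def)
    qed
    ultimately show ?thesis by (rule joined_trans)
  qed
  show ?thesis
  proof (rule that)
    show "last p \<in> Z" "last q \<in> Z" using p q by auto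
    have "last p \<in> set p" "last q \<in> set q" using P[of p] P[of q] p q by (auto simp: is_path_def)
    then show "last p \<noteq> last q" using disj[of p q] p q by auto
    show "joined ?E (?V - X) (last p) (last q)"
      using joined_trans[OF joined_sym[OF tooth[OF p]] tooth[OF q(1)]] .
  qed
qed

text \<open>The star comes from a fork. If it dominated a comb, two of its leaves would be joined
  outside \<open>X\<close>, but the fork puts them into different components.\<close>

lemma undominating_star:
  assumes conn: "connected_graph G" and not: "\<not> unsplit (edges G) (verts G) U"
  obtains S where "subgraph S G" "star_attached_to S U" "\<not> dominating_in S G"
proof -
  let ?E = "edges G" and ?V = "verts G"
  have "conn ?E ?V" using conn by (simp add: connected_graph_iff)
  from not_unsplit_fork[OF this not] obtain X c Z q where X: "finite X" and c: "c \<in> ?V \<inter> X" and Z: "infinite Z" "Z \<subseteq> U"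
    and q: "\<And>z. z \<in> Z \<Longrightarrow> path_in ?E (?V - X) (q z) \<and> last (q z) = z \<and> {c, hd (q z)} \<in> ?E"
    and sep: "\<And>z z'. \<lbrakk>z \<in> Z; z' \<in> Z; z \<noteq> z'\<rbrakk> \<Longrightarrow> \<not> joined ?E (?V - X) z z'"
    by blast
  define p where "p z = c # q z" for z
  let ?P = "p ` Z"
  have ne: "q z \<noteq> []" if "z \<in> Z" for z using q[OF that] by (auto simp: path_in_def is_path_def)
  have last: "last (p z) = z" if "z \<in> Z" for z using q[OF that] ne[OF that] by (simp add: p_def)
  have "inj_on p Z" by (rule inj_onI) (metis last)
  then have inf: "infinite ?P" using Z(1) by (simp add: finite_image_iff)
  have lasts: "last ` ?P = Z" using last by force
  have path: "path_in ?E ?V (p z)" if "z \<in> Z" for z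
    using q[OF that] ne[OF that] c
    by (auto simp: path_in_def is_path_def p_def successively_Cons)
  have disj: "set (p z) \<inter> set (p z') = {c}" if z: "z \<in> Z" "z' \<in> Z" "z \<noteq> z'" for z z'
  proof -
    have "set (q z) \<inter> set (q z') = {}"
      using q[OF z(1)] q[OF z(2)] sep[OF z] by (intro fork_paths_disjoint) auto
    moreover have "c \<notin> set (q z)" "c \<notin> set (q z')"
      using q[OF z(1)] q[OF z(2)] c by (auto simp: path_in_def)
    ultimately show ?thesis by (auto simp: p_def)
  qed
  have star: "is_path s \<and> hd s = c \<and> length s \<ge> 2" if s: "s \<in> ?P" for s
  proof -
    obtain z where z: "z \<in> Z" "s = p z" using s by auto
    then show ?thesis using path[OF z(1)] ne[OF z(1)] by (cases "q z") (auto simp: path_in_def p_def)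
  qed
  have star_disj: "set s \<inter> set s' = {c}" if s: "s \<in> ?P" "s' \<in> ?P" "s \<noteq> s'" for s s'
    using s disj by auto
  let ?S = "graph_Union (path_graph ` ?P)"
  have leaves: "leaves ?S = Z" using star_leaves[OF inf star star_disj] lasts by simp
  have "subdivided_star ?S"
    unfolding subdivided_star_def using inf star star_disj by (intro exI[of _ c] exI[of _ ?P]) blast
  then have "star_attached_to ?S U" using leaves Z(2) by (simp add: star_attached_to_def)
  moreover have "subgraph ?S G"
  proof (rule subgraph_graph_Union)
    fix A assume "A \<in> path_graph ` ?P"
    then obtain z where z: "z \<in> Z" "A = path_graph (p z)" by auto
    then show "subgraph A G"
      using path[OF z(1)] path_graph_subgraph[of "p z" G] by (simp add: path_in_def)
  qed
  moreover have "\<not> dominating_in ?S G"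
  proof
    assume "dominating_in ?S G"
    then obtain C T where C: "subgraph C G" "comb C T" "infinite (Z \<inter> T)"
      unfolding dominating_in_def dominates_def leaves by blast
    obtain x y where "x \<in> Z" "y \<in> Z" "x \<noteq> y" "joined ?E (?V - X) x y"
      using comb_teeth_joined[OF C(2,1) X C(3)] .
    then show False using sep by blast
  qed
  ultimately show ?thesis using that by blast
qed

text \<open>The leaves form an infinite subset of the tough graph \<open>H\<close>, hence are
  unsplit in it, and the comb built for them has all its teeth among the leaves.\<close>

lemma tough_star_dominating:
  assumes H: "subgraph H G" "tough H" "U \<subseteq> verts H" and S: "star_attached_to S U"
  shows "dominating_in S G"
proof -
  obtain c P where P': "infinite P" "\<forall>p\<in>P. is_path p \<and> hd p = c \<and> length p \<ge> 2"
    "\<forall>p\<in>P. \<forall>q\<in>P. p \<noteq> q \<longrightarrow> set p \<inter> set q = {c}" "S = graph_Union (path_graph ` P)"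
    using S unfolding star_attached_to_def subdivided_star_def by (elim exE conjE)
  then have P: "infinite P" "\<And>p. p \<in> P \<Longrightarrow> is_path p \<and> hd p = c \<and> length p \<ge> 2"
    "\<And>p q. \<lbrakk>p \<in> P; q \<in> P; p \<noteq> q\<rbrakk> \<Longrightarrow> set p \<inter> set q = {c}" "S = graph_Union (path_graph ` P)"
    by auto
  have leaves: "leaves S = last ` P" using star_leaves[OF P(1-3)] P(4) by simp
  have "inj_on last P"
  proof (rule inj_onI)
    fix p q assume pq: "p \<in> P" "q \<in> P" "last p = last q"
    have "last p \<noteq> c" "last p \<in> set p" using P(2)[OF pq(1)]
      by (cases p; auto simp: is_path_def)+
    moreover have "last q \<in> set q" using P(2)[OF pq(2)] by (auto simp: is_path_def)
    ultimately show "p = q" using P(3)[OF pq(1,2)] pq(3) by auto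
  qed
  then have inf: "infinite (leaves S)" using P(1) leaves by (simp add: finite_image_iff)
  have sub: "leaves S \<subseteq> verts H" using S H(3) by (auto simp: star_attached_to_def)
  have simple: "simple_graph H" using H(1) by (simp add: subgraph_def)
  have "unsplit (edges H) (verts H) (verts H)" using tough_iff_unsplit[OF simple] H(2) by simp
  then have "unsplit (edges H) (verts H) (leaves S)"
    using sub by (rule unsplit_subset)
  moreover have "infinite (verts H \<inter> leaves S)" using inf sub by (simp add: Int_absorb1)
  ultimately obtain C T where C: "comb C T" "subgraph C H" "infinite T" "T \<subseteq> leaves S"
    using unsplit_comb[OF simple] by blast
  have "subgraph C G" using C(2) H(1) by (auto simp: subgraph_def)
  moreover have "leaves S \<inter> T = T" using C(4) by auto
  ultimately show ?thesis
    unfolding dominating_in_def dominates_def using C by (intro exI[of _ C] exI[of _ T] conjI) simp_all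
qed

section \<open>Extending tough vertex sets\<close>

abbreviation tough_set :: "'a set set \<Rightarrow> 'a set \<Rightarrow> bool" where
  "tough_set E W \<equiv> unsplit E W W"

text \<open>A finite \<open>X\<close> can hit only finitely many of the pieces \<open>Q i\<close>
  and of their anchors \<open>h i\<close>, because the pieces are disjoint and \<open>h\<close> is
  injective. Every other piece stays connected and attached to the rest of \<open>W\<close>; the
  finitely many vertices of the hit pieces and of \<open>F0\<close> may represent
  themselves.\<close>

lemma tough_set_attach:
  assumes W: "tough_set E W" and F0: "finite F0"
    and fin: "\<And>i. i \<in> I \<Longrightarrow> finite (Q i) \<and> conn E (Q i)"
    and disj: "\<And>i j. \<lbrakk>i \<in> I; j \<in> I; i \<noteq> j\<rbrakk> \<Longrightarrow> Q i \<inter> Q j = {}"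
    and h: "inj_on h I" "\<And>i. i \<in> I \<Longrightarrow> h i \<in> W \<and> (\<exists>k\<in>Q i. {k, h i} \<in> E)"
  shows "tough_set E (W \<union> (F0 \<union> (\<Union>i\<in>I. Q i)))" (is "tough_set E ?W")
  unfolding unsplit_def
proof (intro allI impI)
  fix X :: "'a set" assume X: "finite X"
  then obtain R where R: "finite R" "\<forall>u\<in>W \<inter> W - X. \<exists>r\<in>R. joined E (W - X) r u"
    using W unfolding unsplit_def by auto
  let ?J = "{i \<in> I. Q i \<inter> X \<noteq> {}} \<union> {i \<in> I. {h i} \<inter> X \<noteq> {}}"
  have "finite {i \<in> I. Q i \<inter> X \<noteq> {}}" using X disj by (rule finite_disjoint_meeting)
  moreover have "finite {i \<in> I. {h i} \<inter> X \<noteq> {}}"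
    using X by (rule finite_disjoint_meeting) (use h(1) in \<open>auto dest: inj_onD\<close>)
  ultimately have "finite ?J" by simp
  then have fin': "finite (R \<union> F0 \<union> (\<Union>i\<in>?J. Q i))" using R(1) F0 fin by auto
  have old: "\<exists>r\<in>R. joined E (?W - X) r u" if u: "u \<in> W - X" for u
  proof -
    obtain r where r: "r \<in> R" "joined E (W - X) r u" using R(2) u by auto
    have "joined E (?W - X) r u" using r(2) by (rule joined_mono) auto
    then show ?thesis using r(1) by blast
  qed
  have "\<exists>r\<in>R \<union> F0 \<union> (\<Union>i\<in>?J. Q i). joined E (?W - X) r u" if u: "u \<in> ?W - X" for u
  proof (cases "u \<in> W \<or> u \<in> F0 \<union> (\<Union>i\<in>?J. Q i)")
    case True
    then show ?thesis
    proof
      assume "u \<in> W"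
      then show ?thesis using old[of u] u by auto
    next
      assume "u \<in> F0 \<union> (\<Union>i\<in>?J. Q i)"
      then show ?thesis using joined_refl[OF u, of E] by (intro bexI[of _ u]) auto
    qed
  next
    case False
    then obtain i where i: "i \<in> I" "u \<in> Q i" using u by auto
    then have J: "Q i \<inter> X = {}" "h i \<notin> X" using False by auto
    obtain k where k: "k \<in> Q i" "{k, h i} \<in> E" using h(2)[OF i(1)] by auto
    have sub: "Q i \<subseteq> ?W - X" using i(1) J by auto
    have hi: "h i \<in> W - X" using h(2)[OF i(1)] J by auto
    have "joined E (?W - X) k u" using fin[OF i(1)] k(1) i(2) sub by (intro conn_joined[of E "Q i"]) auto
    moreover have "joined E (?W - X) (h i) k"
      using k sub hi by (intro joined_edge) (auto simp: insert_commute)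
    ultimately have "joined E (?W - X) (h i) u" by (metis joined_trans)
    moreover obtain r where "r \<in> R" "joined E (?W - X) r (h i)" using old[OF hi] by auto
    ultimately have "r \<in> R" "joined E (?W - X) r u" using joined_trans[of E "?W - X" r "h i" u] by auto
    then show ?thesis by auto
  qed
  then show "\<exists>R. finite R \<and> (\<forall>u\<in>?W \<inter> ?W - X. \<exists>r\<in>R. joined E (?W - X) r u)"
    using fin' by (intro exI[of _ "R \<union> F0 \<union> (\<Union>i\<in>?J. Q i)"] conjI ballI) blast+
qed

lemma conn_Union:
  assumes "\<And>A. A \<in> \<A> \<Longrightarrow> conn E A \<and> c \<in> A"
  shows "conn E (\<Union> \<A>)"
proof (rule conn_star)
  fix y assume "y \<in> \<Union> \<A>"
  then obtain A where "A \<in> \<A>" "y \<in> A" by auto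
  then show "joined E (\<Union> \<A>) c y" using assms[of A] by (intro conn_joined[of E A]) auto
qed

text \<open>Either one vertex of \<open>D\<close> already has infinitely many neighbours in
  \<open>W\<close>, or there is an infinite matching between \<open>D\<close> and \<open>W\<close>.
  In the latter case a star or a comb-like chain in \<open>D\<close> through infinitely many matched
  vertices splits into finite disjoint pieces, each anchored in \<open>W\<close> by a matching
  edge.\<close>

lemma infinitely_attached_extension:
  assumes W: "tough_set E W" and D: "conn E D" and N: "infinite {w \<in> W. \<exists>k\<in>D. {k, w} \<in> E}"
  obtains F where "F \<subseteq> D" "F \<noteq> {}" "conn E F" "infinite {w \<in> W. \<exists>k\<in>F. {k, w} \<in> E}"
    "tough_set E (W \<union> F)"
proof (cases "\<exists>x\<in>D. infinite {w \<in> W. {x, w} \<in> E}")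
  case True
  then obtain x where x: "x \<in> D" "infinite {w \<in> W. {x, w} \<in> E}" by auto
  have "tough_set E (W \<union> ({x} \<union> (\<Union>i\<in>{}. {})))"
    using W by (rule tough_set_attach[where h = "\<lambda>_. x"]) auto
  then show ?thesis using x by (intro that[of "{x}"]) (auto simp: conn_def joined_refl)
next
  case False
  let ?N = "{w \<in> W. \<exists>k\<in>D. {k, w} \<in> E}"
  have "\<exists>k. \<forall>w\<in>?N. k w \<in> D \<and> {k w, w} \<in> E" by (intro bchoice) auto
  then obtain k where k: "\<forall>w\<in>?N. k w \<in> D \<and> {k w, w} \<in> E" ..
  \<comment> \<open>If \<open>k\<close> took only finitely many values, one of them would be
    adjacent to infinitely many vertices of \<open>W\<close>.\<close>
  have "infinite (k ` ?N)"
  proof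
    assume "finite (k ` ?N)"
    then obtain w where "w \<in> ?N" "infinite {v \<in> ?N. k v = k w}"
      using pigeonhole_infinite[OF N] by blast
    moreover have "{v \<in> ?N. k v = k w} \<subseteq> {v \<in> W. {k w, v} \<in> E}" using k by force
    ultimately have "infinite {v \<in> W. {k w, v} \<in> E}" "k w \<in> D"
      using k infinite_super by blast+
    then show False using False by blast
  qed
  define U where "U = k ` ?N"
  \<comment> \<open>The inverse of \<open>k\<close> on its image is injective, so the edges from
    \<open>u\<close> to \<open>g u\<close> form the matching.\<close>
  define g where "g = inv_into ?N k"
  have U: "infinite U" "U \<subseteq> D" using \<open>infinite (k ` ?N)\<close> k by (auto simp: U_def)
  have g_inj: "inj_on g U" unfolding g_def U_def by (rule inj_on_inv_into) simp
  have gW: "g u \<in> W \<and> {u, g u} \<in> E" if u: "u \<in> U" for u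
  proof -
    have "u \<in> k ` ?N" using u by (simp add: U_def)
    then have g: "g u \<in> ?N" "k (g u) = u"
      using inv_into_into[of u k ?N] f_inv_into_f[of u k ?N] unfolding g_def by blast+
    have "k (g u) \<in> D \<and> {k (g u), g u} \<in> E" using k g(1) by (rule bspec)
    then show ?thesis using g by simp
  qed
  show ?thesis
  \<comment> \<open>If \<open>U\<close> is split in \<open>D\<close>, a fork gives a star with
    leaves in \<open>U\<close>; otherwise a chain of linked paths ends in \<open>U\<close>
    infinitely often.\<close>
  proof (cases "unsplit E D U")
    case False
    then obtain X c Z q where "finite X" and c: "c \<in> D \<inter> X" and Z: "infinite Z" "Z \<subseteq> U"
      and q: "\<And>z. z \<in> Z \<Longrightarrow> path_in E (D - X) (q z) \<and> last (q z) = z \<and> {c, hd (q z)} \<in> E"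
      and sep: "\<And>z z'. \<lbrakk>z \<in> Z; z' \<in> Z; z \<noteq> z'\<rbrakk> \<Longrightarrow> \<not> joined E (D - X) z z'"
      using not_unsplit_fork[OF D False] by blast
    let ?F = "{c} \<union> (\<Union>z\<in>Z. set (q z))"
    have q': "set (q z) \<subseteq> D" "hd (q z) \<in> set (q z)" "z \<in> set (q z)" "conn E (set (q z))"
      if z: "z \<in> Z" for z
      using q[OF z] path_in_conn[of E "D - X" "q z"] last_in_set[of "q z"]
      by (auto simp: path_in_def is_path_def)
    have "conn E ?F"
    proof (rule conn_star)
      fix y assume "y \<in> ?F"
      then consider "y = c" | z where "z \<in> Z" "y \<in> set (q z)" by auto
      then show "joined E ?F c y"
      proof cases
        case 2
        have "joined E ?F c (hd (q z))" using q'(2)[OF 2(1)] q[OF 2(1)] 2(1) by (intro joined_edge) auto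
        moreover have "joined E ?F (hd (q z)) y"
          using q'(2,4)[OF 2(1)] 2 by (intro conn_joined[of E "set (q z)"]) auto
        ultimately show ?thesis by (rule joined_trans)
      qed (auto intro: joined_refl)
    qed
    moreover have "tough_set E (W \<union> ?F)"
    \<comment> \<open>The centre forms the finite part, the legs \<open>q z\<close> are the pieces,
      and the matching partners of the leaves are the anchors.\<close>
    proof (rule tough_set_attach[OF W, where h = g])
      show "set (q z) \<inter> set (q z') = {}" if "z \<in> Z" "z' \<in> Z" "z \<noteq> z'" for z z'
        using q that sep by (intro fork_paths_disjoint[of E "D - X"]) auto
      show "inj_on g Z" using g_inj Z(2) by (rule inj_on_subset)
      show "g z \<in> W \<and> (\<exists>k\<in>set (q z). {k, g z} \<in> E)" if "z \<in> Z" for z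
        using gW[of z] q'(3)[OF that] Z(2) that by auto
    qed (use q' in auto)
    moreover have "infinite {w \<in> W. \<exists>k\<in>?F. {k, w} \<in> E}"
    proof (rule infinite_super)
      show "g ` Z \<subseteq> {w \<in> W. \<exists>k\<in>?F. {k, w} \<in> E}"
      proof
        fix w assume "w \<in> g ` Z"
        then obtain z where z: "z \<in> Z" "w = g z" by auto
        then have "z \<in> ?F" using q'(3) by auto
        then show "w \<in> {w \<in> W. \<exists>k\<in>?F. {k, w} \<in> E}" using gW[of z] z Z(2) by blast
      qed
      show "infinite (g ` Z)"
        using Z(1) inj_on_subset[OF g_inj Z(2)] by (simp add: finite_image_iff)
    qed
    moreover have "?F \<subseteq> D" using c q'(1) by blast
    ultimately show ?thesis by (intro that[of ?F]) auto
  next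
    case True
    have "infinite (D \<inter> U)" using U by (simp add: Int_absorb1)
    from unsplit_chain[OF True this] obtain p :: "nat \<Rightarrow> 'a list" and w where
      p: "\<And>n. path_in E D (p n)" and lastU: "\<And>n. last (p n) \<in> U" and w: "\<And>n. w n \<in> set (p n)"
      and link: "\<And>n. {w n, hd (p (Suc n))} \<in> E"
      and disj: "\<And>m n. m \<noteq> n \<Longrightarrow> set (p m) \<inter> set (p n) = {}" by blast
    let ?F = "\<Union>n. set (p n)"
    have p': "set (p n) \<subseteq> D" "hd (p n) \<in> set (p n)" "last (p n) \<in> set (p n)" "conn E (set (p n))" for n
      using p[of n] path_in_conn[of E D "p n"] by (auto simp: path_in_def is_path_def)
    have inP: "joined E ?F x y" if "x \<in> set (p n)" "y \<in> set (p n)" for x y n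
      using p'(4) that by (rule conn_joined) auto
    have start: "joined E ?F (hd (p 0)) (hd (p n))" for n
    proof (induction n)
      case (Suc n)
      have "joined E ?F (hd (p n)) (w n)" using p'(2) w by (rule inP)
      moreover have "joined E ?F (w n) (hd (p (Suc n)))"
        using w[of n] p'(2)[of "Suc n"] link[of n] by (intro joined_edge) auto
      ultimately show ?case using Suc joined_trans by metis
    qed (use p'(2) in \<open>auto intro: joined_refl\<close>)
    have "conn E ?F"
    proof (rule conn_star)
      fix y assume "y \<in> ?F"
      then obtain n where "y \<in> set (p n)" by auto
      from joined_trans[OF start inP[OF p'(2) this]] show "joined E ?F (hd (p 0)) y" .
    qed
    have inj_last: "inj (\<lambda>n. last (p n))"
    proof (rule injI)
      fix m n assume "last (p m) = last (p n)"
      then have "last (p m) \<in> set (p m) \<inter> set (p n)" using p'(3)[of m] p'(3)[of n] by simp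
      then show "m = n" using disj[of m n] by blast
    qed
    have h_inj: "inj (\<lambda>n. g (last (p n)))"
      using inj_last g_inj lastU by (auto simp: inj_on_def)
    have "tough_set E (W \<union> ({} \<union> ?F))"
    proof (rule tough_set_attach[OF W, where h = "\<lambda>n. g (last (p n))"])
      show "g (last (p n)) \<in> W \<and> (\<exists>k\<in>set (p n). {k, g (last (p n))} \<in> E)" for n
        using gW[OF lastU[of n]] p'(3)[of n] by auto
    qed (use p'(4) disj h_inj in auto)
    moreover have "infinite {w \<in> W. \<exists>k\<in>?F. {k, w} \<in> E}"
    proof (rule infinite_super)
      show "range (\<lambda>n. g (last (p n))) \<subseteq> {w \<in> W. \<exists>k\<in>?F. {k, w} \<in> E}"
      proof
        fix v assume "v \<in> range (\<lambda>n. g (last (p n)))"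
        then obtain n where n: "v = g (last (p n))" by auto
        have "last (p n) \<in> ?F" using p'(3) by auto
        then show "v \<in> {w \<in> W. \<exists>k\<in>?F. {k, w} \<in> E}" using gW[OF lastU[of n]] n by blast
      qed
      show "infinite (range (\<lambda>n. g (last (p n))))" using h_inj by (simp add: finite_image_iff)
    qed
    moreover have "?F \<subseteq> D" using p'(1) by blast
    moreover have "?F \<noteq> {}" using p'(2)[of 0] by blast
    ultimately show ?thesis using \<open>conn E ?F\<close> by (intro that[of ?F]) auto
  qed
qed

text \<open>Join \<open>d\<close> within \<open>D\<close> to one attachment vertex for each of the
  finitely many neighbours of \<open>D\<close> in \<open>W\<close>. The union of these paths is
  finite, so adding it preserves toughness.\<close>

lemma finitely_attached_extension:
  assumes W: "tough_set E W" and D: "conn E D" and d: "d \<in> D"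
    and N: "finite {w \<in> W. \<exists>k\<in>D. {k, w} \<in> E}"
  obtains F where "F \<subseteq> D" "F \<noteq> {}" "conn E F"
    "\<forall>w\<in>W. (\<exists>k\<in>D. {k, w} \<in> E) \<longrightarrow> (\<exists>k\<in>F. {k, w} \<in> E)" "tough_set E (W \<union> F)"
proof -
  let ?N = "{w \<in> W. \<exists>k\<in>D. {k, w} \<in> E}"
  have "\<exists>p. path_in E D p \<and> hd p = d \<and> {last p, w} \<in> E" if w: "w \<in> ?N" for w
  proof -
    obtain k where k: "k \<in> D" "{k, w} \<in> E" using w by auto
    then have "joined E D d k" using D d by (simp add: conn_def)
    then obtain p where "path_in E D p" "hd p = d" "last p = k" by (rule joined_path)
    then show ?thesis using k by auto
  qed
  then have "\<exists>p. \<forall>w\<in>?N. path_in E D (p w) \<and> hd (p w) = d \<and> {last (p w), w} \<in> E"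
    by (intro bchoice ballI)
  then obtain p where p: "\<forall>w\<in>?N. path_in E D (p w) \<and> hd (p w) = d \<and> {last (p w), w} \<in> E" ..
  \<comment> \<open>The set \<open>{d}\<close> is included so that the union is non-empty even if
    \<open>D\<close> has no neighbour in \<open>W\<close>.\<close>
  let ?A = "insert {d} ((\<lambda>w. set (p w)) ` ?N)"
  have p': "set (p w) \<subseteq> D" "conn E (set (p w))" "d \<in> set (p w)" "last (p w) \<in> set (p w)"
    "{last (p w), w} \<in> E" if w: "w \<in> ?N" for w
  proof -
    have pw: "path_in E D (p w) \<and> hd (p w) = d \<and> {last (p w), w} \<in> E" using p w by (rule bspec)
    then show "conn E (set (p w))" by (blast intro: path_in_conn)
    show "set (p w) \<subseteq> D" "d \<in> set (p w)" "last (p w) \<in> set (p w)" "{last (p w), w} \<in> E"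
      using pw hd_in_set[of "p w"] by (auto simp: path_in_def is_path_def)
  qed
  have "conn E (\<Union> ?A)"
  proof (rule conn_Union)
    fix A assume "A \<in> ?A"
    then consider "A = {d}" | w where "w \<in> ?N" "A = set (p w)" by blast
    then show "conn E A \<and> d \<in> A"
    proof cases
      case 1
      then show ?thesis by (simp add: conn_def joined_refl)
    next
      case 2
      then show ?thesis using p'(2,3)[OF 2(1)] by simp
    qed
  qed
  moreover have "tough_set E (W \<union> (\<Union> ?A \<union> (\<Union>i\<in>{}. {})))"
    using W by (rule tough_set_attach[where h = "\<lambda>_. d"]) (use N in auto)
  moreover have "\<Union> ?A \<subseteq> D" using p'(1) d by blast
  moreover have "\<exists>k\<in>\<Union> ?A. {k, w} \<in> E" if "w \<in> W" "\<exists>k\<in>D. {k, w} \<in> E" for w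
  proof -
    have w: "w \<in> ?N" using that by simp
    then have "last (p w) \<in> \<Union> ?A" using p'(4)[OF w] by blast
    then show ?thesis using p'(5)[OF w] by blast
  qed
  ultimately show ?thesis by (intro that[of "\<Union> ?A"]) auto
qed

section \<open>The extension order and limits of chains\<close>

text \<open>
  Adding vertices one piece at a time keeps a set tough, but limits of tough sets need not be tough.
  The order below is fine enough to repair this: after deletion of a finite \<open>X \<subseteq> W\<close>, each component
  of \<open>W' - X\<close> either meets \<open>W\<close> or is the only one inside some component of \<open>V - X\<close> that
  meets \<open>U\<close>, and there are only finitely many of the latter if \<open>U\<close> is unsplit in \<open>V\<close>.
\<close>

definition extends :: "'a set set \<Rightarrow> 'a set \<Rightarrow> 'a set \<Rightarrow> 'a set \<Rightarrow> 'a set \<Rightarrow> bool" where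
  "extends E V U W W' \<longleftrightarrow> W \<subseteq> W' \<and> (\<forall>X q. finite X \<and> X \<subseteq> W \<and> q \<in> W' - X \<longrightarrow>
     (\<exists>w\<in>W - X. joined E (W' - X) q w) \<or>
     (comp_of E (V - X) q \<inter> U \<noteq> {} \<and> (\<forall>q'\<in>W' \<inter> comp_of E (V - X) q. joined E (W' - X) q q')))"

lemma extendsD:
  assumes "extends E V U W W'" "finite X" "X \<subseteq> W" "q \<in> W' - X"
  obtains (old) w where "w \<in> W - X" "joined E (W' - X) q w"
  | (new) "comp_of E (V - X) q \<inter> U \<noteq> {}"
      "\<And>q'. \<lbrakk>q' \<in> W'; q' \<in> comp_of E (V - X) q\<rbrakk> \<Longrightarrow> joined E (W' - X) q q'"
proof -
  have "(\<exists>w\<in>W - X. joined E (W' - X) q w) \<or>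
      (comp_of E (V - X) q \<inter> U \<noteq> {} \<and> (\<forall>q'\<in>W' \<inter> comp_of E (V - X) q. joined E (W' - X) q q'))"
    using assms unfolding extends_def by simp
  then show thesis
  proof (elim disjE bexE conjE)
    fix w assume "w \<in> W - X" "joined E (W' - X) q w"
    then show thesis by (rule old)
  next
    assume n: "comp_of E (V - X) q \<inter> U \<noteq> {}"
      "\<forall>q'\<in>W' \<inter> comp_of E (V - X) q. joined E (W' - X) q q'"
    show thesis by (rule new[OF n(1)]) (use n(2) in simp)
  qed
qed

lemma extendsI:
  assumes "W \<subseteq> W'"
    and "\<And>X q. \<lbrakk>finite X; X \<subseteq> W; q \<in> W' - X; \<And>w. w \<in> W - X \<Longrightarrow> \<not> joined E (W' - X) q w\<rbrakk> \<Longrightarrow>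
      comp_of E (V - X) q \<inter> U \<noteq> {} \<and> (\<forall>q'\<in>W' \<inter> comp_of E (V - X) q. joined E (W' - X) q q')"
  shows "extends E V U W W'"
  unfolding extends_def
proof (intro conjI allI impI)
  fix X q assume X: "finite X \<and> X \<subseteq> W \<and> q \<in> W' - X"
  show "(\<exists>w\<in>W - X. joined E (W' - X) q w) \<or>
      (comp_of E (V - X) q \<inter> U \<noteq> {} \<and> (\<forall>q'\<in>W' \<inter> comp_of E (V - X) q. joined E (W' - X) q q'))"
  proof (cases "\<exists>w\<in>W - X. joined E (W' - X) q w")
    case False
    then show ?thesis using assms(2)[of X q] X by simp
  qed simp
qed (rule assms(1))

lemma extends_refl: "extends E V U W W"
proof (rule extendsI)
  fix X q assume q: "q \<in> W - X" and "\<And>w. w \<in> W - X \<Longrightarrow> \<not> joined E (W - X) q w"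
  then show "comp_of E (V - X) q \<inter> U \<noteq> {} \<and> (\<forall>q'\<in>W \<inter> comp_of E (V - X) q. joined E (W - X) q q')"
    using joined_refl[OF q, of E] by blast
qed simp

text \<open>The delicate case is a vertex \<open>q\<close> joined to some \<open>w'\<close> in
  \<open>W'\<close> but not to \<open>W\<close>. Then the component of \<open>V - X\<close> at
  \<open>w'\<close>, which is also that of \<open>q\<close>, is of the new kind for
  \<open>W'\<close>. Any other vertex of \<open>W''\<close> in it is joined to \<open>W'\<close>
  there, and hence to \<open>w'\<close>, or is itself of the new kind and joined to
  \<open>q\<close>.\<close>

lemma extends_trans:
  assumes 1: "extends E V U W W'" and 2: "extends E V U W' W''" and V: "W'' \<subseteq> V"
  shows "extends E V U W W''"
proof (rule extendsI)
  have sub: "W \<subseteq> W'" "W' \<subseteq> W''" using 1 2 by (auto simp: extends_def)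
  then show "W \<subseteq> W''" by auto
  fix X q assume X: "finite X" "X \<subseteq> W" and q: "q \<in> W'' - X"
    and no: "\<And>w. w \<in> W - X \<Longrightarrow> \<not> joined E (W'' - X) q w"
  let ?C = "comp_of E (V - X)"
  have X': "X \<subseteq> W'" using X(2) sub by auto
  have inV: "joined E (V - X) a b" if "joined E (W'' - X) a b" for a b
    using that by (rule joined_mono) (use V in auto)
  have up: "joined E (W'' - X) a b" if "joined E (W' - X) a b" for a b
    using that by (rule joined_mono) (use sub in auto)
  from 2 X(1) X' q show "?C q \<inter> U \<noteq> {} \<and> (\<forall>q'\<in>W'' \<inter> ?C q. joined E (W'' - X) q q')"
  proof (cases rule: extendsD)
    case (old w')
    have Cq: "?C q = ?C w'" using inV[OF old(2)] by (rule comp_of_eq)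
    from 1 X old(1) show ?thesis
    proof (cases rule: extendsD)
      case old': (old w)
      then show ?thesis using no[of w] joined_trans[OF old(2) up[OF old'(2)]] by simp
    next
      case new
      have "joined E (W'' - X) q q'" if q': "q' \<in> W''" "q' \<in> ?C q" for q'
      proof -
        have "q' \<in> W'' - X" using q' comp_of_subset[of E "V - X" q] by auto
        from 2 X(1) X' this show ?thesis
        proof (cases rule: extendsD)
          case old': (old w'')
          have "joined E (V - X) q w''"
            using q'(2) inV[OF old'(2)] joined_trans[of E "V - X" q q' w''] by (simp add: comp_of_def)
          then have "w'' \<in> ?C w'" using Cq by (auto simp: comp_of_def)
          then have "joined E (W' - X) w' w''" using new(2) old'(1) by simp
          from joined_trans[OF joined_trans[OF old(2) up[OF this]] joined_sym[OF old'(2)]]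
          show ?thesis .
        next
          case new': new
          have "joined E (V - X) q q'" using q'(2) by (simp add: comp_of_def)
          then have "q \<in> ?C q'" using joined_sym[of E "V - X" q q'] by (simp add: comp_of_def)
          then show ?thesis using new'(2)[of q] q joined_sym[of E "W'' - X" q' q] by simp
        qed
      qed
      then show ?thesis using new(1) Cq by simp
    qed
  next
    case new
    then show ?thesis by simp
  qed
qed

text \<open>A vertex \<open>q\<close> of the union that is not joined to \<open>W\<close> in the
  union is not joined to \<open>W\<close> in any member containing \<open>q\<close>, so all these
  members are in the new case. Two vertices of the union lie in a common member, where they can be
  compared.\<close>

lemma extends_chain:
  assumes chain: "\<And>A B. \<lbrakk>A \<in> \<C>; B \<in> \<C>\<rbrakk> \<Longrightarrow> extends E V U A B \<or> extends E V U B A"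
    and W: "W \<in> \<C>"
  shows "extends E V U W (\<Union>\<C>)"
proof (rule extendsI)
  show "W \<subseteq> \<Union>\<C>" using W by auto
  fix X q assume X: "finite X" "X \<subseteq> W" and q: "q \<in> \<Union>\<C> - X"
    and no: "\<And>w. w \<in> W - X \<Longrightarrow> \<not> joined E (\<Union>\<C> - X) q w"
  let ?C = "comp_of E (V - X) q"
  have up: "joined E (\<Union>\<C> - X) a b" if "joined E (B - X) a b" "B \<in> \<C>" for a b B
    using that(1) by (rule joined_mono) (use that(2) in auto)
  have new: "?C \<inter> U \<noteq> {} \<and> (\<forall>q'\<in>B \<inter> ?C. joined E (B - X) q q')" if B: "B \<in> \<C>" "q \<in> B" for B
  proof -
    have "q \<notin> W" using no[of q] q joined_refl[of q "\<Union>\<C> - X" E] by auto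
    then have "\<not> extends E V U B W" using B(2) by (auto simp: extends_def)
    then have ext: "extends E V U W B" using chain[OF W B(1)] by auto
    have "q \<in> B - X" using q B by auto
    from ext X this show ?thesis
    proof (cases rule: extendsD)
      case (old w)
      then show ?thesis using no[of w] up[OF old(2) B(1)] by simp
    qed auto
  qed
  obtain A where A: "A \<in> \<C>" "q \<in> A" using q by auto
  have "joined E (\<Union>\<C> - X) q q'" if q': "q' \<in> \<Union>\<C> \<inter> ?C" for q'
  proof -
    obtain B where B: "B \<in> \<C>" "q' \<in> B" using q' by auto
    have "A \<subseteq> B \<or> B \<subseteq> A" using chain[OF A(1) B(1)] by (auto simp: extends_def)
    then obtain D where "D \<in> \<C>" "q \<in> D" "q' \<in> D" using A B by blast
    then show ?thesis using new[of D] up[of D q q'] q' by auto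
  qed
  then show "?C \<inter> U \<noteq> {} \<and> (\<forall>q'\<in>\<Union>\<C> \<inter> ?C. joined E (\<Union>\<C> - X) q q')" using new[OF A] by blast
qed

text \<open>By finiteness the relevant part of the deleted set lies in one member \<open>W\<close>.
  Components of the rest of the union that meet \<open>W\<close> are represented by those of
  \<open>W\<close>; each remaining one is alone in a component of \<open>V - X\<close> meeting
  \<open>U\<close>, and there are finitely many of these.\<close>

lemma tough_set_chain:
  assumes chain: "\<And>A B. \<lbrakk>A \<in> \<C>; B \<in> \<C>\<rbrakk> \<Longrightarrow> extends E V U A B \<or> extends E V U B A"
    and tough: "\<And>A. A \<in> \<C> \<Longrightarrow> tough_set E A"
    and U: "unsplit E V U"
  shows "tough_set E (\<Union>\<C>)"
proof (cases "\<C> = {}")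
  case True
  then show ?thesis by (auto simp: unsplit_def)
next
  case False
  let ?M = "\<Union>\<C>"
  show ?thesis
    unfolding unsplit_def
  proof (intro allI impI)
    fix X0 :: "'a set" assume X0: "finite X0"
    define X where "X = X0 \<inter> ?M"
    have X: "finite X" "X \<subseteq> ?M" and MX: "?M - X0 = ?M - X" using X0 by (auto simp: X_def)
    have "subset.chain UNIV \<C>"
      using chain by (auto simp: subset_chain_def extends_def)
    then obtain W where W: "W \<in> \<C>" "X \<subseteq> W"
      using finite_subset_Union_chain[OF X False] by blast
    obtain R where R: "finite R" "\<forall>u\<in>W \<inter> W - X. \<exists>r\<in>R. joined E (W - X) r u"
      using tough[OF W(1)] X(1) unfolding unsplit_def by auto
    obtain S where S: "finite S" "\<forall>u\<in>U \<inter> V - X. \<exists>r\<in>S. joined E (V - X) r u"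
      using U X(1) unfolding unsplit_def by auto
    have ext: "extends E V U W ?M" using chain W(1) by (rule extends_chain)
    \<comment> \<open>For a representative \<open>r\<close> of a component of \<open>V - X\<close>,
      \<open>f r\<close> selects a vertex to which all vertices of the union in that component are
      joined. Its value matters only where such a vertex exists.\<close>
    define new where "new r q \<longleftrightarrow> joined E (V - X) r q \<and>
      (\<forall>q'\<in>?M \<inter> comp_of E (V - X) q. joined E (?M - X) q q')" for r q
    define f where "f r = (SOME q. new r q)" for r
    have "\<exists>r\<in>R \<union> f ` S. joined E (?M - X) r q" if q: "q \<in> ?M - X" for q
      using ext X(1) W(2) q
    proof (cases rule: extendsD)
      case (old w)
      then obtain r where r: "r \<in> R" "joined E (W - X) r w" using R(2) by auto
      have "joined E (?M - X) r w" using r(2) by (rule joined_mono) (use W(1) in auto)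
      then show ?thesis using r(1) joined_trans[OF _ joined_sym[OF old(2)]] by blast
    next
      case n: new
      then obtain u where u: "u \<in> U" "joined E (V - X) q u" by (auto simp: comp_of_def)
      then have "u \<in> U \<inter> V - X" using joined_in(2)[OF u(2)] by auto
      then obtain r where r: "r \<in> S" "joined E (V - X) r u" using S(2) by blast
      have rq: "joined E (V - X) r q" using joined_trans[OF r(2) joined_sym[OF u(2)]] .
      then have "new r q" using n(2) by (simp add: new_def)
      then have f: "new r (f r)" unfolding f_def by (rule someI)
      then have "joined E (V - X) (f r) q"
        using joined_trans[OF joined_sym rq] by (simp add: new_def)
      then have "joined E (?M - X) (f r) q" using f q by (auto simp: new_def comp_of_def)
      then show ?thesis using r(1) by blast
    qed
    then show "\<exists>R. finite R \<and> (\<forall>u\<in>?M \<inter> ?M - X0. \<exists>r\<in>R. joined E (?M - X0) r u)"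
      unfolding Int_absorb MX using R(1) S(1) by (intro exI[of _ "R \<union> f ` S"] conjI ballI) auto
  qed
qed

text \<open>The added set \<open>F\<close> lies in the component \<open>?D\<close> of
  \<open>V - W\<close> at \<open>u\<close>. If a finite \<open>X\<close> cuts \<open>F\<close> off
  from \<open>W\<close>, it must contain all neighbours of \<open>?D\<close>. Then the component of
  \<open>V - X\<close> at \<open>F\<close> stays inside \<open>?D\<close>, contains
  \<open>u\<close>, and meets the new set only in the connected set \<open>F\<close>.\<close>

lemma proper_extension:
  assumes W: "W \<subseteq> V" "tough_set E W" and u: "u \<in> U" "u \<in> V - W"
  obtains W' where "W \<subset> W'" "W' \<subseteq> V" "tough_set E W'" "extends E V U W W'"
proof -
  let ?D = "comp_of E (V - W) u"
  let ?N = "{w \<in> W. \<exists>k\<in>?D. {k, w} \<in> E}"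
  have uD: "u \<in> ?D" using u(2) by (rule comp_of_self)
  have D_sub: "?D \<subseteq> V - W" by (rule comp_of_subset)
  obtain F where F: "F \<subseteq> ?D" "F \<noteq> {}" "conn E F" "tough_set E (W \<union> F)"
    \<comment> \<open>This is the common consequence of both cases: \<open>F\<close> sees every
      neighbour of \<open>?D\<close> if these are finitely many, and otherwise too many neighbours
      for a finite \<open>X\<close> to contain.\<close>
    and att: "\<And>X. finite X \<Longrightarrow> ?N \<subseteq> X \<or> (\<exists>w\<in>W - X. \<exists>k\<in>F. {k, w} \<in> E)"
  proof (cases "finite ?N")
    case True
    obtain F where F: "F \<subseteq> ?D" "F \<noteq> {}" "conn E F"
      "\<forall>w\<in>W. (\<exists>k\<in>?D. {k, w} \<in> E) \<longrightarrow> (\<exists>k\<in>F. {k, w} \<in> E)" "tough_set E (W \<union> F)"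
      by (rule finitely_attached_extension[OF W(2) conn_comp_of uD True])
    show ?thesis
    proof (rule that[OF F(1-3,5)])
      show "?N \<subseteq> X \<or> (\<exists>w\<in>W - X. \<exists>k\<in>F. {k, w} \<in> E)" for X
      proof (cases "?N \<subseteq> X")
        case False
        then obtain w where "w \<in> ?N" "w \<notin> X" by auto
        then show ?thesis using F(4) by auto
      qed simp
    qed
  next
    case False
    obtain F where F: "F \<subseteq> ?D" "F \<noteq> {}" "conn E F" "infinite {w \<in> W. \<exists>k\<in>F. {k, w} \<in> E}"
      "tough_set E (W \<union> F)"
      by (rule infinitely_attached_extension[OF W(2) conn_comp_of False])
    have *: "\<exists>w\<in>W - X. \<exists>k\<in>F. {k, w} \<in> E" if X: "finite X" for X
    proof -
      have "\<not> {w \<in> W. \<exists>k\<in>F. {k, w} \<in> E} \<subseteq> X" using F(4) X finite_subset by blast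
      then show ?thesis by blast
    qed
    show ?thesis by (rule that[OF F(1-3,5)]) (intro disjI2 *)
  qed
  show ?thesis
  proof (rule that)
    show "W \<subset> W \<union> F" "W \<union> F \<subseteq> V" using F(1,2) D_sub W(1) by blast+
    show "tough_set E (W \<union> F)" by (rule F(4))
    show "extends E V U W (W \<union> F)"
    proof (rule extendsI)
      fix X q assume X: "finite X" "X \<subseteq> W" and q: "q \<in> W \<union> F - X"
        and no: "\<And>w. w \<in> W - X \<Longrightarrow> \<not> joined E (W \<union> F - X) q w"
      have "q \<notin> W" using no[of q] joined_refl[OF q, of E] q by blast
      then have qF: "q \<in> F" using q by auto
      have F_sub: "F \<subseteq> W \<union> F - X" using F(1) D_sub X(2) by auto
      have inF: "joined E (W \<union> F - X) q k" if "k \<in> F" for k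
        using F(3) qF that F_sub by (rule conn_joined)
      have "\<not> (\<exists>w\<in>W - X. \<exists>k\<in>F. {k, w} \<in> E)"
      proof
        assume "\<exists>w\<in>W - X. \<exists>k\<in>F. {k, w} \<in> E"
        then obtain w k where wk: "w \<in> W - X" "k \<in> F" "{k, w} \<in> E" by auto
        then have "joined E (W \<union> F - X) k w" using F_sub by (intro joined_edge) auto
        then show False using no[OF wk(1)] joined_trans[OF inF[OF wk(2)]] by blast
      qed
      then have N: "?N \<subseteq> X" using att[OF X(1)] by blast
      have "comp_of E (V - X) q \<subseteq> ?D"
      proof
        fix y assume "y \<in> comp_of E (V - X) q"
        then have y: "joined E (V - X) q y" by (simp add: comp_of_def)
        show "y \<in> ?D"
        proof (rule ccontr)
          assume yD: "y \<notin> ?D"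
          have "q \<in> ?D" using qF F(1) by auto
          from y this yD obtain a b where ab: "a \<in> ?D" "b \<notin> ?D" "b \<in> V - X" "{a, b} \<in> E"
            by (rule joined_exit)
          \<comment> \<open>An edge leaving the component \<open>?D\<close> of \<open>V - W\<close>
            can only lead into \<open>W\<close>, hence to a neighbour of \<open>?D\<close>, all of
            which were deleted.\<close>
          have "b \<in> W" using comp_of_closed[OF ab(1) _ ab(4)] ab(2,3) by blast
          then have "b \<in> ?N" using ab(1,4) by blast
          then show False using N ab(3) by blast
        qed
      qed
      moreover have "u \<in> comp_of E (V - X) q"
      proof -
        have "joined E ?D q u" using conn_comp_of[of E "V - W" u] qF F(1) uD by (auto simp: conn_def)
        then have "joined E (V - X) q u" by (rule joined_mono) (use D_sub X(2) in auto)
        then show ?thesis by (simp add: comp_of_def)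
      qed
      ultimately show "comp_of E (V - X) q \<inter> U \<noteq> {} \<and>
          (\<forall>q'\<in>(W \<union> F) \<inter> comp_of E (V - X) q. joined E (W \<union> F - X) q q')"
        using u(1) inF D_sub by blast
    qed auto
  qed
qed

text \<open>A maximal element for \<open>extends\<close> contains \<open>U\<close>, since a missing
  vertex of \<open>U\<close> would allow a proper extension. The union of a chain is an upper bound
  in this order and stays tough because \<open>U\<close> is unsplit in \<open>V\<close>; the empty
  chain is bounded by the empty set.\<close>

lemma tough_superset:
  assumes "U \<subseteq> V" "unsplit E V U"
  obtains W where "U \<subseteq> W" "W \<subseteq> V" "tough_set E W"
proof -
  let ?A = "{W. W \<subseteq> V \<and> tough_set E W}"
  have "\<exists>m\<in>?A. \<forall>a\<in>?A. extends E V U m a \<longrightarrow> a = m"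
  proof (rule predicate_Zorn)
    show "partial_order_on ?A (relation_of (extends E V U) ?A)"
    proof (rule partial_order_on_relation_ofI)
      show "extends E V U a c" if "c \<in> ?A" "extends E V U a b" "extends E V U b c" for a b c
        using extends_trans[OF that(2,3)] that(1) by simp
    qed (auto simp: extends_refl, auto simp: extends_def)
    fix C assume C: "C \<in> Chains (relation_of (extends E V U) ?A)"
    then have CA: "C \<subseteq> ?A" by (rule Chains_relation_of)
    have chain: "extends E V U A B \<or> extends E V U B A" if "A \<in> C" "B \<in> C" for A B
      using C that by (auto simp: Chains_def relation_of_def)
    have "tough_set E (\<Union>C)" by (rule tough_set_chain[OF chain _ assms(2)]) (use CA in auto)
    then have "\<Union>C \<in> ?A" using CA by auto
    then show "\<exists>m\<in>?A. \<forall>a\<in>C. extends E V U a m"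
      using extends_chain[OF chain] by blast
  qed
  then obtain W where "W \<in> ?A" and max: "\<forall>W'\<in>?A. extends E V U W W' \<longrightarrow> W' = W" ..
  then have W: "W \<subseteq> V" "tough_set E W" by auto
  have "U \<subseteq> W"
  proof
    fix u assume u: "u \<in> U"
    show "u \<in> W"
    proof (rule ccontr)
      assume "u \<notin> W"
      then have "u \<in> V - W" using u assms(1) by auto
      with W u obtain W' where W': "W \<subset> W'" "W' \<subseteq> V" "tough_set E W'" "extends E V U W W'"
        by (rule proper_extension)
      then have "W' = W" using max by simp
      then show False using W'(1) by simp
    qed
  qed
  then show ?thesis using W by (rule that)
qed

theorem theorem1:
  fixes G :: "'a graph" and U :: "'a set"
  assumes "connected_graph G"
    and "U \<subseteq> verts G"
  shows "(\<exists>S. subgraph S G \<and> star_attached_to S U \<and> \<not> dominating_in S G) \<longleftrightarrow>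
    \<not> (\<exists>H. subgraph H G \<and> tough H \<and> U \<subseteq> verts H)"
proof (intro iffI notI)
  assume "\<exists>S. subgraph S G \<and> star_attached_to S U \<and> \<not> dominating_in S G"
    and "\<exists>H. subgraph H G \<and> tough H \<and> U \<subseteq> verts H"
  then show False using tough_star_dominating by blast
next
  assume no: "\<not> (\<exists>H. subgraph H G \<and> tough H \<and> U \<subseteq> verts H)"
  have "\<not> unsplit (edges G) (verts G) U"
  proof
    assume "unsplit (edges G) (verts G) U"
    with assms(2) obtain W where W: "U \<subseteq> W" "W \<subseteq> verts G" "tough_set (edges G) W"
      by (rule tough_superset)
    \<comment> \<open>The graph induced on \<open>W\<close> has all edges of \<open>G\<close> inside
      \<open>W\<close>, so joinedness within subsets of \<open>W\<close> is unchanged.\<close>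
    let ?H = "\<lparr>verts = W, edges = {e \<in> edges G. e \<subseteq> W}\<rparr>"
    have simple: "simple_graph ?H"
      unfolding simple_graph_def
    proof
      fix e assume "e \<in> edges ?H"
      then have e: "e \<in> edges G" "e \<subseteq> W" by auto
      then obtain a b where "a \<noteq> b" "e = {a, b}"
        using assms(1) by (fastforce simp: connected_graph_def simple_graph_def)
      then show "\<exists>a\<in>verts ?H. \<exists>b\<in>verts ?H. a \<noteq> b \<and> e = {a, b}" using e by auto
    qed
    have "joined (edges ?H) (W - X) = joined (edges G) (W - X)" for X
      by (rule joined_edge_cong) auto
    then have "tough_set (edges ?H) W" using W(3) unfolding unsplit_def by simp
    then have "tough ?H" using tough_iff_unsplit[OF simple] by simp
    moreover have "subgraph ?H G" using simple W(2) by (auto simp: subgraph_def)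
    moreover have "U \<subseteq> verts ?H" using W(1) by simp
    ultimately show False using no by blast
  qed
  then show "\<exists>S. subgraph S G \<and> star_attached_to S U \<and> \<not> dominating_in S G"
    by (rule undominating_star[OF assms(1)]) blast
qed

end
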